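(* There is no $2$-connected nontrivial uniquely $C_9$-saturated graph whose longest even cycle of length at most $12$ has length $6$.
   Context: All graphs are finite and simple. A graph $G$ is uniquely $C_9$-saturated if it contains no cycle of length $9$ and, for every edge $e$ of the complement $\overline{G}$, $G+e$ contains exactly one cycle of length $9$; it is nontrivial if $|V(G)|\ge 9$. "Longest even cycle of length at most $12$" means a longest cycle among all even cycles of $G$ whose length is at most $12$; so the condition says that $G$ contains a $6$-cycle but no cycle of length $8$, $10$ or $12$. *)

theory Defs
  imports "Graph_Theory.Graph_Theory"
begin

text \<open>
  Finite simple graphs are rendered by the locale \<^locale>\<open>pair_graph\<close>: finite, loop-free,
  symmetric relations, so an undirected edge \<open>uv\<close> is the pair of arcs \<open>(u, v)\<close>, \<open>(v, u)\<close>.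
\<close>

definition add_edge :: "'a pair_pre_digraph \<Rightarrow> 'a \<Rightarrow> 'a \<Rightarrow> 'a pair_pre_digraph" where
  "add_edge G u v = G\<lparr> parcs := parcs G \<union> {(u, v), (v, u)} \<rparr>"

definition walk_edges :: "('a \<times> 'a) awalk \<Rightarrow> 'a set set" where
  "walk_edges p = (\<lambda>(u, v). {u, v}) ` set p"

text \<open>
  The cycles of length \<open>n\<close> of \<open>G\<close>, as subgraphs. The library's cycles are closed arc walks, so each
  cyclic subgraph arises from several of them (choice of starting vertex and orientation); passing
  to the set of undirected edges, which determines the subgraph, identifies these. The condition
  \<open>3 \<le> n\<close> removes the closed walks \<open>u, v, u\<close>, which the library counts as cycles.
\<close>

definition cycles_of_length :: "nat \<Rightarrow> 'a pair_pre_digraph \<Rightarrow> 'a set set set" where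
  "cycles_of_length n G =
    {walk_edges p | p. pre_digraph.cycle (with_proj G) p \<and> length p = n \<and> 3 \<le> n}"

definition uniquely_cycle_saturated :: "nat \<Rightarrow> 'a pair_pre_digraph \<Rightarrow> bool" where
  "uniquely_cycle_saturated k G \<longleftrightarrow>
    cycles_of_length k G = {} \<and>
    (\<forall>u \<in> pverts G. \<forall>v \<in> pverts G. u \<noteq> v \<and> (u, v) \<notin> parcs G \<longrightarrow>
      (\<exists>!C. C \<in> cycles_of_length k (add_edge G u v)))"

definition two_connected :: "'a pair_pre_digraph \<Rightarrow> bool" where
  "two_connected G \<longleftrightarrow>
    3 \<le> card (pverts G) \<and> connected (with_proj G) \<and>
    (\<forall>v \<in> pverts G. connected (pre_digraph.del_vert (with_proj G) v))"

definition longest_even_cycle_length_upto :: "nat \<Rightarrow> 'a pair_pre_digraph \<Rightarrow> nat \<Rightarrow> bool" where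
  "longest_even_cycle_length_upto m G l \<longleftrightarrow>
    even l \<and> l \<le> m \<and> cycles_of_length l G \<noteq> {} \<and>
    (\<forall>n. even n \<and> n \<le> m \<and> cycles_of_length n G \<noteq> {} \<longrightarrow> n \<le> l)"

end

theory Submission
  imports Defs "HOL-Combinatorics.Transposition"
begin

text \<open>
  Call a path on nine vertices long. For an edge of the complement, the cycles of length 9 that it
  closes are the long paths between its ends, so the hypothesis on \<open>G\<close> reads: two non-adjacent vertices
  are the ends of exactly one long path, two adjacent ones of none. Moreover \<open>G\<close> has a hexagon (a cycle
  of length 6) but no cycle of length 8, 9 or 10. A hexagon then leaves so little room for long paths
  that it must span a complete graph, and complete graphs in \<open>G\<close> keep growing until they contain a
  cycle of length 8.

  The heart of the matter is \<open>hexagon_short_chord\<close>: in a hexagon \<open>c0 c1 c2 c3 c4 c5\<close> the vertices \<open>c0\<close> and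
  \<open>c2\<close> are adjacent. Otherwise there is a long path from \<open>c0\<close> to \<open>c2\<close>. If it avoided \<open>c1\<close>, it would close
  up through \<open>c1\<close> to a cycle of length 10; if \<open>c1\<close> were next to one of its ends, there would be a cycle of
  length 8. So \<open>c1\<close> is one of its five middle vertices, and reflecting the hexagon one may assume that it
  is the third, fourth or fifth vertex. What remains is a finite search. Every further vertex of the path
  is either one of the vertices named so far or a new one, each choice adds edges to the known part of
  \<open>G\<close>, and almost every choice creates at once a cycle of length 8, 9 or 10, or two long paths with the
  same ends. The few configurations that survive until the path is complete are refuted in the same way:
  they contain two vertices that can neither be adjacent nor be the ends of a long path. The search is
  recorded in explicit trees; a function \<open>check\<close> verifies such a tree, \<open>check_sound\<close> shows that a verified
  tree excludes the configuration at its root, and the simplifier evaluates \<open>check\<close>.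

  Applied to all hexagons on the same six vertices, the lemma shows that these are pairwise adjacent
  (\<open>hexagon_clique\<close>). A second, much smaller search shows that a vertex adjacent to one vertex of a
  6-clique is adjacent to all of them (\<open>clique_pendant\<close>). As \<open>G\<close> is connected and has at least nine
  vertices, the 6-clique therefore grows to a 7-clique and then to an 8-clique, which contains a cycle
  of length 8.
\<close>

section \<open>Cycles, long paths and the saturation condition on vertex lists\<close>

lemma nine_ends:
  assumes "length xs = 9"
  shows "hd xs = xs ! 0" "last xs = xs ! 8"
proof -
  have "xs \<noteq> []" using assms by auto
  then show "hd xs = xs ! 0" "last xs = xs ! 8"
    using assms by (auto simp: hd_conv_nth last_conv_nth)
qed

text \<open>A cycle is given by the list of its vertices; it is closed up by repeating the last vertex in front.
  A long path is a list of nine vertices, at the positions 0 to 8.\<close>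

locale unique_long_paths =
  fixes V :: "'a set" and adj :: "'a \<Rightarrow> 'a \<Rightarrow> bool"
  assumes adj_sym: "adj x y \<Longrightarrow> adj y x"
    and adj_irrefl: "\<not> adj x x"
    and adj_in: "adj x y \<Longrightarrow> x \<in> V"
    and no_cycle: "\<lbrakk>length xs \<in> {8, 9, 10}; distinct xs; successively adj (last xs # xs)\<rbrakk> \<Longrightarrow> False"
    and path_unique: "\<lbrakk>length xs = 9; length ys = 9; distinct xs; distinct ys; successively adj xs;
      successively adj ys; hd xs = hd ys; last xs = last ys\<rbrakk> \<Longrightarrow> xs = ys"
    and path_exists: "\<lbrakk>u \<in> V; v \<in> V; u \<noteq> v; \<not> adj u v\<rbrakk> \<Longrightarrow>
      \<exists>xs. length xs = 9 \<and> distinct xs \<and> successively adj xs \<and> hd xs = u \<and> last xs = v"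
begin

lemma adj_commute: "adj x y \<longleftrightarrow> adj y x"
  using adj_sym by blast

text \<open>Otherwise the path closes up through the common neighbour to a cycle of length 10, or of
  length 8 when the neighbour is next to an end of the path.\<close>

lemma path_through_common_neighbour:
  assumes xs: "length xs = 9" "distinct xs" "successively adj xs"
    and w: "adj (hd xs) w" "adj w (last xs)"
  obtains i where "i \<in> {2, 3, 4, 5, 6}" "xs ! i = w"
proof -
  note ends = nine_ends[OF xs(1)]
  have ne: "xs \<noteq> []" using xs(1) by auto
  have "w \<in> set xs"
  proof (rule ccontr)
    assume "w \<notin> set xs"
    moreover have "successively adj (w # xs @ [w])"
      using w xs ne by (auto simp: successively_append_iff successively_Cons adj_commute hd_append)
    ultimately show False
      using no_cycle[of "xs @ [w]"] xs by auto
  qed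
  then obtain i where i: "i < 9" "xs ! i = w"
    using xs(1) by (auto simp: in_set_conv_nth)
  have "i \<noteq> 0" "i \<noteq> 8"
    using i w adj_irrefl ends by metis+
  moreover have "i \<noteq> 1"
  proof
    assume "i = 1"
    obtain x ys where "xs = x # ys" using xs(1) by (cases xs) auto
    moreover from this obtain y zs where "ys = y # zs" using xs(1) by (cases ys) auto
    moreover from calculation have "y = w" using i \<open>i = 1\<close> by simp
    ultimately show False
      using no_cycle[of ys] xs w by (auto simp: adj_commute)
  qed
  moreover have "i \<noteq> 7"
  proof
    assume "i = 7"
    obtain x ys where ys: "xs = ys @ [x]" using xs(1) by (cases xs rule: rev_cases) auto
    moreover from this obtain y zs where "ys = zs @ [y]" using xs(1) by (cases ys rule: rev_cases) auto
    moreover from calculation have "y = w" using i xs(1) \<open>i = 7\<close> by (simp add: nth_append)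
    moreover have "successively adj ys" "hd xs = hd ys"
      using calculation xs(1,3) by (auto simp: successively_append_iff hd_append)
    ultimately show False
      using no_cycle[of ys] xs w by (auto simp: successively_Cons adj_commute)
  qed
  moreover have "i = 0 \<or> i = 1 \<or> i = 2 \<or> i = 3 \<or> i = 4 \<or> i = 5 \<or> i = 6 \<or> i = 7 \<or> i = 8"
    using i(1) by linarith
  ultimately show thesis using that i(2) by auto
qed

end

section \<open>Search trees and their verification\<close>

text \<open>
  A configuration consists of vertices named by the numbers below \<open>n\<close>, a list \<open>E\<close> of edges between them,
  and a long path of which some positions are known: \<open>P\<close> lists pairs of a position and the label of the
  vertex found there. A search tree is meant to refute a configuration, in one of the following ways.
  \<^item> \<open>Cyc\<close> and \<open>Twin\<close> are leaves: they exhibit, inside \<open>E\<close>, a cycle of length 8, 9 or 10, respectively two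
    long paths with the same ends.
  \<^item> \<open>At i ts\<close> asks which vertex is at position \<open>i\<close> of the path. There is one subtree for each label that
    is not yet on the path, in increasing order, and a last one for a vertex without a label, which
    is then called \<open>n\<close>.
  \<^item> \<open>Like v\<close> replaces a subtree of \<open>At\<close>: the label is exchangeable with \<open>v\<close>, which has been refuted at
    this position already.
  \<^item> \<open>Join u v s t\<close> uses saturation: either \<open>u\<close> and \<open>v\<close> are adjacent, which \<open>s\<close> refutes, or there is a
    long path between them, which \<open>t\<close> refutes in place of the present path.
  \<^item> \<open>Via w ts\<close> uses \<open>path_through_common_neighbour\<close> for a path of which only the ends are known and a
    common neighbour \<open>w\<close> of these; the subtrees treat the positions 2 to 6 of \<open>w\<close>.
\<close>

datatype search =
    Cyc "nat list"
  | Twin "nat list" "nat list"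
  | is_Like: Like (original: nat)
  | At nat "search list"
  | Join nat nat search search
  | Via nat "search list"

type_synonym edges = "(nat \<times> nat) list"
type_synonym positions = "(nat \<times> nat) list"

text \<open>The nested conditionals let the simplifier stop at the first edge that fits.\<close>

fun joined :: "edges \<Rightarrow> nat \<Rightarrow> nat \<Rightarrow> bool" where
  "joined [] a b = False"
| "joined ((c, d) # E) a b =
    (if (if c = a then d = b else False) then True
     else if (if c = b then d = a else False) then True else joined E a b)"

definition new_edges :: "positions \<Rightarrow> nat \<Rightarrow> nat \<Rightarrow> edges" where
  "new_edges P i w = map (\<lambda>(j, v). (w, v)) (filter (\<lambda>(j, v). j = i + 1 \<or> i = j + 1) P)"

text \<open>In \<open>check_labels\<close>, the list \<open>D\<close> collects the labels that have been refuted at position \<open>i\<close>; these are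
  the ones that a later \<open>Like\<close> may refer to.\<close>

function check :: "nat \<Rightarrow> edges \<Rightarrow> positions \<Rightarrow> search \<Rightarrow> bool"
  and check_labels :: "nat \<Rightarrow> edges \<Rightarrow> positions \<Rightarrow> nat \<Rightarrow> nat list \<Rightarrow> nat list \<Rightarrow> search list \<Rightarrow> bool"
  and check_positions :: "nat \<Rightarrow> edges \<Rightarrow> positions \<Rightarrow> nat \<Rightarrow> nat list \<Rightarrow> search list \<Rightarrow> bool"
where
  "check n E P (Cyc xs) =
    (length xs \<in> {8, 9, 10} \<and> distinct xs \<and> successively (joined E) (last xs # xs))"
| "check n E P (Twin xs ys) =
    (length xs = 9 \<and> length ys = 9 \<and> distinct xs \<and> distinct ys \<and> hd xs = hd ys \<and> last xs = last ys \<and>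
     xs \<noteq> ys \<and> successively (joined E) xs \<and> successively (joined E) ys)"
| "check n E P (Like v) = False"
| "check n E P (At i ts) =
    (0 < i \<and> i < 8 \<and> i \<notin> fst ` set P \<and>
     check_labels n E P i [] (filter (\<lambda>w. w \<notin> snd ` set P) [0..<n] @ [n]) ts)"
| "check n E P (Join u v s t) =
    (u < n \<and> v < n \<and> u \<noteq> v \<and> check n ((u, v) # E) P s \<and> check n E [(0, u), (8, v)] t)"
| "check n E P (Via w ts) =
    (map fst P = [0, 8] \<and> joined E (snd (hd P)) w \<and> joined E w (snd (last P)) \<and>
     check_positions n E P w [2, 3, 4, 5, 6] ts)"
| "check_labels n E P i D (w # ws) (t # ts) =
    ((if is_Like t
      then original t \<in> set D \<and> original t < n \<and> w < n \<and>
        (\<forall>(x, y) \<in> set E. joined E (transpose (original t) w x) (transpose (original t) w y))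
      else check (if w = n then n + 1 else n) (new_edges P i w @ E) ((i, w) # P) t) \<and>
     check_labels n E P i (w # D) ws ts)"
| "check_labels n E P i D [] [] = True"
| "check_labels n E P i D (w # ws) [] = False"
| "check_labels n E P i D [] (t # ts) = False"
| "check_positions n E P w (i # is) (t # ts) =
    (check n (new_edges P i w @ E) ((i, w) # P) t \<and> check_positions n E P w is ts)"
| "check_positions n E P w [] [] = True"
| "check_positions n E P w (i # is) [] = False"
| "check_positions n E P w [] (t # ts) = False"
  by pat_completeness auto
termination
  by (relation "measure (\<lambda>x. case x of Inl (n, E, P, t) \<Rightarrow> size t
      | Inr (Inl (n, E, P, i, D, ws, ts)) \<Rightarrow> size_list size ts
      | Inr (Inr (n, E, P, w, is, ts)) \<Rightarrow> size_list size ts)") auto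

lemma joinedE:
  assumes "joined E a b"
  obtains "(a, b) \<in> set E" | "(b, a) \<in> set E"
  using assms by (induction E a b rule: joined.induct) (auto split: if_splits)

lemma successively_linked:
  "successively R (a # xs) \<Longrightarrow> x \<in> set xs \<Longrightarrow> \<exists>y. R y x"
  by (induction xs arbitrary: a) (auto simp: successively_Cons)

context unique_long_paths
begin

definition embeds :: "nat \<Rightarrow> edges \<Rightarrow> (nat \<Rightarrow> 'a) \<Rightarrow> bool" where
  "embeds n E f \<longleftrightarrow> inj_on f {..<n} \<and> f ` {..<n} \<subseteq> V \<and>
    (\<forall>(a, b) \<in> set E. a < n \<and> b < n \<and> adj (f a) (f b))"

definition long_path :: "nat \<Rightarrow> (nat \<Rightarrow> 'a) \<Rightarrow> positions \<Rightarrow> 'a list \<Rightarrow> bool" where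
  "long_path n f P xs \<longleftrightarrow> length xs = 9 \<and> distinct xs \<and> successively adj xs \<and>
    (\<forall>(i, w) \<in> set P. i < 9 \<and> w < n \<and> xs ! i = f w)"

lemma embeds_joined:
  assumes "embeds n E f" "joined E a b"
  shows "a < n" "b < n" "adj (f a) (f b)"
  using assms(2) by (rule joinedE; use assms(1) in \<open>auto simp: embeds_def adj_commute\<close>)+

lemma embeds_walk:
  assumes f: "embeds n E f" and xs: "successively (joined E) xs" "distinct xs"
    "set xs \<subseteq> {..<n}"
  shows "successively adj (map f xs)" "distinct (map f xs)"
proof -
  show "successively adj (map f xs)"
    unfolding successively_map
    by (rule successively_mono[OF xs(1)]) (use embeds_joined[OF f] in blast)
  show "distinct (map f xs)"
    using f xs by (auto simp: distinct_map embeds_def intro: inj_on_subset)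
qed

text \<open>Precomposing with a transposition that is an automorphism of \<open>E\<close> gives another way of seeing the same
  configuration in the graph; this is what makes \<open>Like\<close> sound.\<close>

lemma embeds_transpose:
  assumes f: "embeds n E f" and "v < n" "w < n"
    and E: "\<forall>(x, y) \<in> set E. joined E (transpose v w x) (transpose v w y)"
  shows "embeds n E (f \<circ> transpose v w)"
proof -
  have im: "transpose v w ` {..<n} = {..<n}"
    using \<open>v < n\<close> \<open>w < n\<close> by (intro transpose_image_eq) auto
  have "inj_on (f \<circ> transpose v w) {..<n}"
    using f by (intro comp_inj_on) (simp_all add: im embeds_def)
  moreover have "(f \<circ> transpose v w) ` {..<n} \<subseteq> V"
    using f by (simp only: image_comp[symmetric] im) (simp add: embeds_def)
  ultimately show ?thesis
    using f E embeds_joined[OF f] by (auto simp: embeds_def split_beta)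
qed

lemma long_path_place:
  assumes f: "embeds n E f" and xs: "long_path n f P xs" and w: "w < n" and i: "i < 9" "xs ! i = f w"
  shows "embeds n (new_edges P i w @ E) f" "long_path n f ((i, w) # P) xs"
proof -
  have "w < n \<and> v < n \<and> adj (f w) (f v)" if "(j, v) \<in> set P" "j = i + 1 \<or> i = j + 1" for j v
  proof -
    have "j < 9" "v < n" "xs ! j = f v" using xs that(1) by (auto simp: long_path_def)
    then show ?thesis
      using that(2) w i xs successively_nth[of adj xs i] successively_nth[of adj xs j]
      by (auto simp: long_path_def adj_commute)
  qed
  then show "embeds n (new_edges P i w @ E) f"
    using f by (auto simp: embeds_def new_edges_def)
  show "long_path n f ((i, w) # P) xs"
    using xs w i by (auto simp: long_path_def)
qed

lemma embeds_fresh: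
  assumes f: "embeds n E f" and xs: "long_path n f P xs" and i: "i < 9" "xs ! i \<notin> f ` {..<n}"
    and "xs ! i \<in> V"
  shows "embeds (n + 1) E (f(n := xs ! i))" "long_path (n + 1) (f(n := xs ! i)) P xs"
proof -
  have inj: "inj_on (f(n := xs ! i)) {..<n + 1}"
    using f i(2) by (simp add: embeds_def lessThan_Suc inj_on_def) (metis image_eqI lessThan_iff nat_neq_iff)
  show "embeds (n + 1) E (f(n := xs ! i))"
    using f inj \<open>xs ! i \<in> V\<close> by (fastforce simp: embeds_def lessThan_Suc)
  show "long_path (n + 1) (f(n := xs ! i)) P xs"
    using xs by (fastforce simp: long_path_def)
qed

lemma long_path_vertex:
  assumes "long_path n f P xs" "i < 9"
  shows "xs ! i \<in> V"
proof (cases "i = 8")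
  case True
  then have "adj (xs ! 7) (xs ! i)"
    using assms successively_nth[of adj xs 7] by (simp add: long_path_def)
  then show ?thesis using adj_in adj_sym by blast
next
  case False
  then have "adj (xs ! i) (xs ! Suc i)"
    using assms successively_nth[of adj xs i] by (simp add: long_path_def)
  then show ?thesis by (rule adj_in)
qed

text \<open>
  The refutation has to hold for every embedding \<open>f\<close> at once: \<open>Like\<close> and the introduction of a new label
  both pass to a different embedding. Of the list \<open>ws\<close> of candidates for position \<open>i\<close>, the label \<open>n\<close> stands
  for all vertices outside the image of \<open>f\<close>, so refuting it means that the vertex at position \<open>i\<close> is in
  that image.
\<close>

lemma check_sound:
  "check n E P t \<Longrightarrow> embeds n E f \<Longrightarrow> long_path n f P xs \<Longrightarrow> False"
  "check_labels n E P i D ws ts \<Longrightarrow> 0 < i \<Longrightarrow> i < 8 \<Longrightarrow>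
    set D \<union> set ws \<subseteq> {..n} - snd ` set P \<Longrightarrow>
    (\<forall>w \<in> set D. \<forall>f xs. embeds n E f \<longrightarrow> long_path n f P xs \<longrightarrow> w < n \<longrightarrow> xs ! i \<noteq> f w) \<Longrightarrow>
    embeds n E f \<Longrightarrow> long_path n f P xs \<Longrightarrow> w \<in> set ws \<Longrightarrow>
    (if w = n then xs ! i \<in> f ` {..<n} else xs ! i \<noteq> f w)"
  "check_positions n E P w is ts \<Longrightarrow> embeds n E f \<Longrightarrow> long_path n f P xs \<Longrightarrow>
    w < n \<Longrightarrow> i \<in> set is \<Longrightarrow> i < 9 \<Longrightarrow> xs ! i \<noteq> f w"
proof (induction n E P t and n E P i D ws ts and n E P w "is" ts
    arbitrary: f xs and f xs w and f xs i rule: check_check_labels_check_positions.induct)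
  case (1 n E P ys)
  have ys: "ys \<noteq> []" "distinct ys" "successively (joined E) (last ys # ys)"
    using 1 by auto
  have sub: "set ys \<subseteq> {..<n}"
    using successively_linked[OF ys(3)] embeds_joined(2)[OF 1(2)] by blast
  have "successively adj (map f (last ys # ys))"
    unfolding successively_map
    by (rule successively_mono[OF ys(3)]) (use embeds_joined[OF 1(2)] in blast)
  moreover have "distinct (map f ys)"
    using 1(2) sub ys(2) by (auto simp: distinct_map embeds_def intro: inj_on_subset)
  ultimately show False
    using no_cycle[of "map f ys"] 1(1) ys(1) by (simp add: last_map)
next
  case (2 n E P ys zs)
  have sub: "set us \<subseteq> {..<n}" if us: "successively (joined E) us" "length us = 9" for us
  proof -
    obtain a b us' where [simp]: "us = a # b # us'"
      using us(2) by (auto simp: numeral_eq_Suc length_Suc_conv)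
    have "joined E a b" using us(1) by simp
    then show ?thesis
      using successively_linked[of "joined E" a "b # us'"] us(1) embeds_joined[OF 2(2)] by fastforce
  qed
  have "ys \<noteq> []" "zs \<noteq> []" using 2(1) by auto
  then have "map f ys = map f zs"
    using 2(1) sub[of ys] sub[of zs] embeds_walk[OF 2(2)]
    by (intro path_unique) (auto simp: hd_map last_map)
  moreover have "inj_on f (set ys \<union> set zs)"
    using 2 sub[of ys] sub[of zs] by (auto simp: embeds_def intro: inj_on_subset)
  ultimately show False
    using 2(1) by (auto dest: map_inj_on)
next
  case (4 n E P i ts)
  let ?ws = "filter (\<lambda>w. w \<notin> snd ` set P) [0..<n] @ [n]"
  have i: "0 < i" "i < 8" "i \<notin> fst ` set P" using 4(2) by auto
  have P: "snd ` set P \<subseteq> {..<n}" using 4(4) by (auto simp: long_path_def)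
  have sub: "set [] \<union> set ?ws \<subseteq> {..n} - snd ` set P"
  proof -
    have "n \<notin> snd ` set P" using P by blast
    then show ?thesis by auto
  qed
  have labels: "if w = n then xs ! i \<in> f ` {..<n} else xs ! i \<noteq> f w" if "w \<in> set ?ws" for w
    using 4(1)[OF _ i(1,2) sub _ 4(3,4) that] 4(2) by simp
  obtain w where w: "w < n" "xs ! i = f w" using labels[of n] by auto
  have "w \<in> snd ` set P"
    by (rule ccontr) (use labels[of w] w in auto)
  (* all labels off the path are refuted, so a vertex of the path would occur on it twice *)
  then obtain j where "(j, w) \<in> set P" by auto
  then have "xs ! j = xs ! i" "j < 9" "j \<noteq> i"
    using 4(4) i w by (force simp: long_path_def)+
  then show False
    using 4(4) i by (auto simp: long_path_def nth_eq_iff_index_eq)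
next
  case (5 n E P u v s t)
  have u: "u < n" "v < n" "u \<noteq> v" using 5(3) by auto
  then have V: "f u \<in> V" "f v \<in> V" "f u \<noteq> f v"
    using 5(4) by (auto simp: embeds_def inj_on_def)
  show False
  proof (cases "adj (f u) (f v)")
    case True
    then have "embeds n ((u, v) # E) f" using 5(4) u by (auto simp: embeds_def)
    then show False using 5(1)[of f xs] 5(3,5) by simp
  next
    case False
    then obtain ys where "length ys = 9" "distinct ys" "successively adj ys" "hd ys = f u" "last ys = f v"
      using path_exists[OF V] by auto
    then have "long_path n f [(0, u), (8, v)] ys"
      using u nine_ends[of ys] by (simp add: long_path_def)
    then show False using 5(2)[of f ys] 5(3,4) by simp
  qed
next
  case (6 n E P w ts)
  obtain u v where P: "P = [(0, u), (8, v)]"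
    using 6(2) by (auto simp: map_eq_Cons_conv)
  then have uv: "joined E u w" "joined E w v"
    and ch: "check_positions n E P w [2, 3, 4, 5, 6] ts"
    using 6(2) by simp_all
  have xs: "length xs = 9" "distinct xs" "successively adj xs"
    using 6(4) by (simp_all add: long_path_def)
  have ends: "hd xs = f u" "last xs = f v"
    using 6(4) P nine_ends[OF xs(1)] by (simp_all add: long_path_def)
  obtain i where i: "i \<in> {2, 3, 4, 5, 6}" "xs ! i = f w"
    by (rule path_through_common_neighbour[OF xs, of "f w"])
      (use ends embeds_joined(3)[OF 6(3)] uv in simp_all)
  have "xs ! i \<noteq> f w"
    using 6(1)[of f xs i] ch i(1) embeds_joined(1)[OF 6(3) uv(2)] 6(3,4) P uv by auto
  then show False using i(2) by simp
next
  case (7 n E P i D v ws t ts)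
  note lab = \<open>set D \<union> set (v # ws) \<subseteq> {..n} - snd ` set P\<close>
  have i9: "i < 9" using 7(5) by simp
  have v: "if v = n then xs ! i \<in> f ` {..<n} else xs ! i \<noteq> f v"
    if f: "embeds n E f" and xs: "long_path n f P xs" for f xs
  proof (cases "is_Like t")
    case True
    let ?u = "original t"
    let ?g = "f \<circ> transpose ?u v"
    have u: "?u \<in> set D" "?u < n" "v < n"
      and E: "\<forall>(x, y) \<in> set E. joined E (transpose ?u v x) (transpose ?u v y)"
      using 7(3) True by auto
    have g: "embeds n E ?g"
      using f u E by (intro embeds_transpose) auto
    have P: "?u \<notin> snd ` set P" "v \<notin> snd ` set P"
      using lab u by auto
    have "?g (snd p) = f (snd p)" if "p \<in> set P" for p
    proof -
      have "snd p \<in> snd ` set P" using that by (rule imageI)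
      then have "snd p \<noteq> ?u" "snd p \<noteq> v" using P by metis+
      then show ?thesis by simp
    qed
    then have "long_path n ?g P xs"
      using xs by (simp add: long_path_def split_beta del: comp_apply)
    then have "xs ! i \<noteq> ?g ?u"
      using 7(7) g u by blast
    then show ?thesis using u by simp
  next
    case False
    then have ch: "check (if v = n then n + 1 else n) (new_edges P i v @ E) ((i, v) # P) t"
      using 7(3) by auto
    show ?thesis
    proof (cases "v = n")
      case True
      have "False" if new: "xs ! i \<notin> f ` {..<n}"
      proof -
        note fresh = embeds_fresh[OF f xs i9 new long_path_vertex[OF xs i9]]
        (* the vertex at position i receives the label n *)
        have "xs ! i = (f(n := xs ! i)) n" by simp
        note place = long_path_place[OF fresh _ i9 this]
        show False
          using 7(1)[OF False ch] place True by simp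
      qed
      then show ?thesis using True by auto
    next
      case neq: False
      then have "v < n" using lab by auto
      have False if eq: "xs ! i = f v"
        using 7(1)[OF False ch] long_path_place[OF f xs \<open>v < n\<close> i9 eq] neq by simp
      then show ?thesis using neq by auto
    qed
  qed
  show ?case
  proof (cases "w = v")
    case True
    then show ?thesis using v[OF 7(8,9)] by simp
  next
    case False
    have "\<forall>u\<in>set (v # D). \<forall>f xs. embeds n E f \<longrightarrow> long_path n f P xs \<longrightarrow> u < n \<longrightarrow> xs ! i \<noteq> f u"
    proof (intro ballI allI impI)
      fix u f xs
      assume "u \<in> set (v # D)" and f: "embeds n E f" and xs: "long_path n f P xs" and "u < n"
      then consider "u = v" | "u \<in> set D" by auto
      then show "xs ! i \<noteq> f u"
      proof cases
        case 1
        then show ?thesis using v[OF f xs] \<open>u < n\<close> by simp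
      next
        case 2
        then show ?thesis using 7(7) f xs \<open>u < n\<close> by blast
      qed
    qed
    moreover have "set (v # D) \<union> set ws \<subseteq> {..n} - snd ` set P"
      using lab by auto
    moreover have "w \<in> set ws" using 7(10) False by simp
    ultimately show ?thesis
      using 7(2)[OF _ 7(4,5) _ _ 7(8,9)] 7(3) by simp
  qed
next
  case (11 n E P v j "is" t ts)
  show ?case
  proof
    assume eq: "xs ! i = f v"
    have "i = j"
      using 11(2)[of f xs i] 11(3-) eq by auto
    then show False
      using 11(1)[of f xs] long_path_place[OF 11(4,5,6,8) eq] 11(3) by simp
  qed
qed auto

end

section \<open>The two searches\<close>

definition hexagon_edges :: edges where
  "hexagon_edges = [(0, 1), (1, 2), (2, 3), (3, 4), (4, 5), (5, 0)]"

definition clique_pendant_edges :: edges where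
  "clique_pendant_edges = [(0, 1), (0, 2), (0, 3), (0, 4), (0, 5), (1, 2), (1, 3), (1, 4), (1, 5), (2, 3),
     (2, 4), (2, 5), (3, 4), (3, 5), (4, 5), (0, 6)]"

text \<open>
  The trees come from a depth-first search that tries, at each node, the positions next to a known one
  and keeps the smallest tree that it finds. The number in the name of a hexagon tree is the position of
  the vertex 1 on the long path from 0 to 2.
\<close>

definition hexagon_tree_2 :: search where
  "hexagon_tree_2 =
    At 7 [At 6 [At 1 [At 3 [At 4 [At 5 [Join 1 3 (Twin [0,5,1,6,7,8,4,3,2] [0,5,4,8,7,6,1,3,2]) (Via 2
    [At 1 [Cyc [0,1,6,7,8,4,3,2], Twin [0,5,1,6,7,8,4,2,3] [0,5,4,8,7,6,1,2,3], Cyc [1,5,2,3,4,8,7,6],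
    Cyc [0,1,2,6,7,8,4,5], Cyc [0,1,6,7,2,3,4,5], Cyc [1,5,4,3,2,8,7,6], Cyc [1,6,7,8,4,3,2,9]], At 2
    [Cyc [0,1,6,7,8,4,3,2], Twin [0,5,1,6,7,8,4,2,3] [0,5,4,8,7,6,1,2,3], Cyc [1,5,2,3,4,8,7,6], Cyc
    [0,1,2,6,7,8,4,5], Cyc [0,1,6,7,2,3,4,5], Cyc [1,5,4,3,2,8,7,6], Twin [0,1,6,7,8,4,3,2,9]
    [0,5,4,8,7,6,1,2,9]], At 3 [Cyc [0,1,6,7,8,4,3,2], Twin [0,5,1,6,7,8,4,2,3] [0,5,4,8,7,6,1,2,3], Cyc
    [1,5,2,3,4,8,7,6], Cyc [0,1,2,6,7,8,4,5], Cyc [0,1,6,7,2,3,4,5], Cyc [1,5,4,3,2,8,7,6], Twin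
    [0,1,6,7,8,4,3,2,9] [0,5,4,8,7,6,1,2,9]], At 4 [Cyc [0,1,6,7,8,4,3,2], Twin [0,5,1,6,7,8,4,2,3]
    [0,5,4,8,7,6,1,2,3], Cyc [1,5,2,3,4,8,7,6], Cyc [0,1,2,6,7,8,4,5], Cyc [0,1,6,7,2,3,4,5], Cyc
    [1,5,4,3,2,8,7,6], Twin [0,1,6,7,8,4,3,2,9] [0,5,4,8,7,6,1,2,9]], At 5 [Cyc [0,1,6,7,8,4,3,2], Twin
    [0,5,1,6,7,8,4,2,3] [0,5,4,8,7,6,1,2,3], Cyc [1,5,2,3,4,8,7,6], Cyc [0,1,2,6,7,8,4,5], Cyc
    [0,1,6,7,2,3,4,5], Cyc [1,5,4,3,2,8,7,6], Twin [0,1,6,7,8,4,3,2,9] [0,5,4,8,7,6,1,2,9]]])]]], At 3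
    [At 4 [At 5 [Cyc [0,1,2,3,4,8,7,5]]], At 4 [At 5 [Cyc [0,5,8,4,3,2,1,6]], At 5 [Join 1 8 (Twin
    [6,0,1,2,3,4,5,8,7] [6,0,5,4,3,2,1,8,7]) (Via 7 [At 1 [Cyc [0,1,2,3,4,5,8,7], Cyc [0,5,4,3,2,7,1,6],
    Cyc [0,5,8,7,3,2,1,6], Cyc [0,1,2,3,4,7,8,5], Twin [6,0,1,2,3,4,5,7,8] [6,0,5,4,3,2,1,7,8], Cyc
    [0,5,4,3,2,1,7,6], Cyc [1,2,3,4,5,8,7,9]], At 2 [Cyc [0,1,2,3,4,5,8,7], Cyc [0,5,4,3,2,7,1,6], Cyc
    [0,5,8,7,3,2,1,6], Cyc [0,1,2,3,4,7,8,5], Twin [6,0,1,2,3,4,5,7,8] [6,0,5,4,3,2,1,7,8], Cyc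
    [0,5,4,3,2,1,7,6], Twin [6,0,5,4,3,2,1,7,9] [6,1,2,3,4,5,8,7,9]], At 3 [Cyc [0,1,2,3,4,5,8,7], Cyc
    [0,5,4,3,2,7,1,6], Cyc [0,5,8,7,3,2,1,6], Cyc [0,1,2,3,4,7,8,5], Twin [6,0,1,2,3,4,5,7,8]
    [6,0,5,4,3,2,1,7,8], Cyc [0,5,4,3,2,1,7,6], Twin [6,0,5,4,3,2,1,7,9] [6,1,2,3,4,5,8,7,9]], At 4 [Cyc
    [0,1,2,3,4,5,8,7], Cyc [0,5,4,3,2,7,1,6], Cyc [0,5,8,7,3,2,1,6], Cyc [0,1,2,3,4,7,8,5], Twin
    [6,0,1,2,3,4,5,7,8] [6,0,5,4,3,2,1,7,8], Cyc [0,5,4,3,2,1,7,6], Twin [6,0,5,4,3,2,1,7,9]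
    [6,1,2,3,4,5,8,7,9]], At 5 [Cyc [0,1,2,3,4,5,8,7], Cyc [0,5,4,3,2,7,1,6], Cyc [0,5,8,7,3,2,1,6], Cyc
    [0,1,2,3,4,7,8,5], Twin [6,0,1,2,3,4,5,7,8] [6,0,5,4,3,2,1,7,8], Cyc [0,5,4,3,2,1,7,6], Twin
    [6,0,5,4,3,2,1,7,9] [6,1,2,3,4,5,8,7,9]]]), Cyc [0,5,4,9,8,7,1,6]]]]], At 3 [At 1 [At 4 [At 5 [Cyc
    [0,1,2,3,4,7,8,5]]]], At 4 [At 1 [At 5 [Cyc [0,5,8,4,3,2,1,7]]], At 5 [At 1 [Cyc [0,5,3,4,7,6,1,8]],
    Cyc [1,2,3,4,5,8,7,6]]]], At 5 [At 1 [At 3 [At 4 [Join 1 8 (Twin [0,5,1,2,3,6,4,8,7]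
    [0,5,4,6,3,2,1,8,7]) (Via 7 [At 1 [Cyc [0,1,2,3,6,4,8,7], Cyc [0,1,7,2,3,6,4,5], Cyc
    [0,1,2,3,7,8,4,5], Twin [0,5,1,2,3,6,4,7,8] [0,5,4,6,3,2,1,7,8], Cyc [0,1,2,3,4,8,7,5], Cyc
    [1,2,3,6,7,8,4,5], Cyc [1,2,3,6,4,8,7,9]], At 2 [Cyc [0,1,2,3,6,4,8,7], Cyc [0,1,7,2,3,6,4,5], Cyc
    [0,1,2,3,7,8,4,5], Twin [0,5,1,2,3,6,4,7,8] [0,5,4,6,3,2,1,7,8], Cyc [0,1,2,3,4,8,7,5], Cyc
    [1,2,3,6,7,8,4,5], Twin [0,1,2,3,6,4,8,7,9] [0,5,1,2,3,4,8,7,9]], At 3 [Cyc [0,1,2,3,6,4,8,7], Cyc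
    [0,1,7,2,3,6,4,5], Cyc [0,1,2,3,7,8,4,5], Twin [0,5,1,2,3,6,4,7,8] [0,5,4,6,3,2,1,7,8], Cyc
    [0,1,2,3,4,8,7,5], Cyc [1,2,3,6,7,8,4,5], Twin [0,1,2,3,6,4,8,7,9] [0,5,1,2,3,4,8,7,9]], At 4 [Cyc
    [0,1,2,3,6,4,8,7], Cyc [0,1,7,2,3,6,4,5], Cyc [0,1,2,3,7,8,4,5], Twin [0,5,1,2,3,6,4,7,8]
    [0,5,4,6,3,2,1,7,8], Cyc [0,1,2,3,4,8,7,5], Cyc [1,2,3,6,7,8,4,5], Twin [0,1,2,3,6,4,8,7,9]
    [0,5,1,2,3,4,8,7,9]], At 5 [Cyc [0,1,2,3,6,4,8,7], Cyc [0,1,7,2,3,6,4,5], Cyc [0,1,2,3,7,8,4,5],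
    Twin [0,5,1,2,3,6,4,7,8] [0,5,4,6,3,2,1,7,8], Cyc [0,1,2,3,4,8,7,5], Cyc [1,2,3,6,7,8,4,5], Twin
    [0,1,2,3,6,4,8,7,9] [0,5,1,2,3,4,8,7,9]]])]], Cyc [0,5,4,6,3,2,1,7]], At 1 [At 3 [At 4 [Cyc
    [0,1,7,8,5,6,3,4]]], At 3 [At 4 [Cyc [0,5,8,4,3,2,1,7]], At 4 [Cyc [0,5,6,3,4,8,1,7], Twin
    [0,7,1,2,3,4,5,9,8] [0,7,1,2,3,6,5,9,8]]]], At 4 [Cyc [0,1,2,3,6,7,4,5], At 1 [Cyc
    [0,1,2,3,6,7,5,4], Cyc [0,5,7,6,3,2,1,8]], At 3 [Cyc [0,1,2,3,6,7,8,4,5], Cyc [0,1,2,3,6,7,8,5], Cyc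
    [0,1,9,8,7,6,3,4,5]]]]], At 6 [At 3 [At 1 [At 4 [At 5 [Cyc [0,1,2,4,3,8,7,5]]]], At 4 [At 1 [At 5
    [Cyc [0,5,8,3,4,2,1,7]]], At 5 [At 1 [Twin [0,8,1,2,3,4,5,7,6] [0,8,1,2,4,3,5,7,6]], Cyc
    [0,1,6,7,8,3,4,5]]]], At 3 [At 1 [At 4 [At 5 [Cyc [0,1,2,4,3,7,8,5]]]], At 4 [At 1 [Cyc
    [0,5,4,2,3,6,1,7]], At 5 [Cyc [0,1,6,7,3,2,4,5], Cyc [1,2,3,4,5,8,7,6]]]], At 5 [At 1 [At 3 [At 4
    [Cyc [0,1,7,8,3,2,4,5]]], Cyc [0,5,4,6,3,2,1,7]], At 1 [At 3 [At 4 [Cyc [0,1,7,8,5,4,2,3]]], Cyc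
    [0,5,6,4,3,2,1,7]], At 4 [Cyc [0,1,2,3,7,6,4,5], Cyc [0,1,2,3,4,6,7,5], At 3 [Cyc [0,1,3,8,7,6,4,5],
    Cyc [0,1,2,4,6,7,8,5], Cyc [0,1,9,8,7,6,4,5]]]]], At 3 [At 4 [At 1 [At 5 [At 6 [Cyc
    [0,1,2,3,4,7,8,5]]]], At 5 [At 1 [Cyc [0,5,4,6,3,2,1,7]], At 6 [Cyc [0,1,2,3,6,7,4,5], Cyc
    [0,1,2,3,6,7,8,5]]]], At 1 [At 4 [At 5 [At 6 [Cyc [0,1,3,4,6,7,8,5]]]], At 4 [At 5 [At 6 [Cyc
    [0,5,8,7,3,2,1,6]]], At 5 [Cyc [0,5,2,3,7,4,1,6], Twin [3,2,1,6,0,5,4,7,8] [3,2,5,0,6,1,4,7,8]]]],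
    At 4 [At 1 [At 5 [At 6 [Cyc [0,1,2,3,7,8,5,4]]], At 5 [At 6 [Cyc [0,5,8,4,3,2,1,7]], At 6 [Cyc
    [0,5,4,8,3,2,1,7], Cyc [0,5,9,8,3,2,1,7]]]], At 1 [At 5 [At 6 [Cyc [0,1,2,3,4,7,8,5]]], Cyc
    [0,5,2,3,4,6,1,7]], At 5 [At 1 [Cyc [0,1,6,7,3,2,5,4], Cyc [0,5,2,3,7,6,1,8]], Cyc
    [0,1,6,7,4,3,2,5], At 1 [Twin [0,3,4,5,2,1,6,7,8] [0,5,4,3,2,1,6,7,8], Twin [0,5,2,3,4,1,6,7,8]
    [0,5,4,3,2,1,6,7,8], Twin [3,2,5,0,9,1,6,7,8] [3,4,5,0,9,1,6,7,8]]]]], At 6 [At 1 [At 5 [At 3 [At 4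
    [Cyc [0,4,3,2,1,7,8,5]]], At 4 [Cyc [0,1,2,6,3,7,5,4], Twin [5,0,4,1,2,6,3,7,8]
    [5,4,0,1,2,6,3,7,8]]], At 3 [At 4 [At 5 [Cyc [0,1,2,3,8,7,4,5]]], At 4 [At 5 [Cyc
    [0,1,2,6,3,8,4,5]], At 5 [Twin [0,5,1,7,8,4,3,2,6] [0,5,4,8,7,1,2,3,6], Cyc [0,1,7,8,9,3,4,5]]]],
    Cyc [0,5,4,3,6,2,1,7]], At 3 [At 1 [At 4 [At 5 [Cyc [0,1,2,3,7,8,4,5]]], Cyc [0,5,4,6,2,3,1,7]], At
    4 [At 1 [Cyc [0,5,3,4,6,2,1,7]], At 5 [Cyc [0,1,2,6,4,3,7,5], Cyc [0,1,2,3,4,8,7,5]]], At 4 [Cyc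
    [0,1,7,3,2,6,4,5], At 1 [Cyc [0,1,7,5,4,6,2,3], Twin [3,2,6,4,5,7,1,0,8] [3,4,6,2,1,7,5,0,8]], At 5
    [Cyc [0,1,7,8,3,2,6,4,5], Twin [0,1,7,8,5,4,3,2,6] [0,5,8,7,1,2,3,4,6], Twin [0,5,4,3,2,1,7,8,9]
    [0,5,4,6,2,1,7,8,9]]]], At 3 [At 1 [At 4 [At 5 [Cyc [0,1,2,3,7,8,5,4]]], At 4 [At 5 [Cyc
    [0,5,8,4,3,2,1,7]], At 5 [Cyc [0,5,4,8,3,2,1,7], Cyc [0,5,9,8,3,2,1,7]]]], At 1 [At 4 [At 5 [Cyc
    [0,1,2,3,4,7,8,5]]], Cyc [0,5,6,2,3,4,1,7]], At 4 [At 1 [Cyc [0,1,7,3,2,6,5,4], Cyc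
    [0,5,6,2,3,7,1,8]], Cyc [0,1,7,4,3,2,6,5], At 5 [Cyc [0,1,7,8,3,2,6,5], Cyc [0,1,7,8,4,3,2,6,5], Cyc
    [1,2,3,4,5,9,8,7]]]], At 5 [Cyc [0,1,2,6,7,3,4,5], At 1 [Cyc [0,1,3,2,6,7,4,5], At 3 [Cyc
    [0,1,3,2,6,7,4,5], At 4 [Cyc [1,5,4,7,6,2,3,8], Twin [0,1,8,9,4,3,2,6,7] [0,5,4,9,8,1,2,6,7]]], Cyc
    [0,5,4,7,6,2,1,8]], At 3 [At 1 [Cyc [0,1,3,2,6,7,5,4], Cyc [0,5,7,6,2,3,1,8]], Cyc
    [0,1,4,3,2,6,7,5], At 4 [Cyc [0,1,8,3,2,6,7,5], Cyc [0,1,8,4,3,2,6,7,5], Twin [3,2,6,7,5,0,1,8,9]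
    [3,4,5,7,6,2,1,8,9]]], At 4 [Cyc [0,1,2,6,7,8,3,4,5], Cyc [0,1,2,6,7,8,4,5], At 1 [Cyc
    [0,1,3,2,6,7,8,5], Cyc [0,1,2,6,7,8,5,4], Cyc [0,5,8,7,6,2,1,9]], At 3 [Cyc [0,1,2,6,7,8,9,3,4,5],
    Cyc [0,1,2,6,7,8,9,4,5], Cyc [0,1,2,6,7,8,9,5], Twin [4,3,2,1,10,9,8,7,6] [4,5,0,1,10,9,8,7,6]]]]]]"

definition hexagon_tree_3 :: search where
  "hexagon_tree_3 =
    At 1 [At 7 [At 2 [At 4 [At 5 [At 6 [Cyc [0,1,6,7,8,4,2,3]]]], At 4 [At 5 [At 6 [Cyc
    [0,1,2,3,4,8,7,5]]], At 5 [At 6 [Cyc [0,1,6,3,2,4,8,5]], Twin [6,3,0,5,4,2,1,7,8]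
    [6,3,2,4,5,0,1,7,8]]]], At 4 [At 2 [At 5 [At 6 [Cyc [0,1,2,3,4,7,8,5]]]], At 5 [At 6 [Cyc
    [0,1,6,4,7,5,2,3]], At 6 [Cyc [0,1,6,7,4,3,2,5], Cyc [0,1,6,7,8,5,2,3]]]], At 6 [At 2 [At 4 [At 5
    [Cyc [0,1,7,8,4,6,2,3]]], Cyc [0,1,7,3,2,6,4,5]], At 4 [At 5 [Cyc [0,1,2,6,5,7,4,3]], At 5 [Cyc
    [0,1,7,4,3,2,6,5], Cyc [0,1,7,8,5,6,2,3]]], At 2 [At 5 [Cyc [0,1,2,6,7,5,4,3], Twin
    [1,0,5,4,3,2,6,7,8] [1,4,5,0,3,2,6,7,8]], At 5 [Cyc [0,1,2,6,7,4,3,5], Twin [0,1,5,4,3,2,6,7,8]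
    [0,3,4,5,1,2,6,7,8]], Twin [4,5,0,1,8,3,2,6,7] [4,5,0,3,8,1,2,6,7]]]], At 7 [At 4 [At 2 [At 5 [At 6
    [Cyc [0,1,2,3,8,7,5,4]]]], At 5 [At 2 [At 6 [Cyc [0,4,7,1,2,3,8,5]]], At 6 [Cyc [0,4,3,2,1,6,7,5],
    Cyc [0,1,6,7,8,3,4,5]]]], At 2 [At 4 [At 5 [At 6 [Cyc [0,4,3,1,6,7,8,5]]]], At 6 [At 4 [At 5 [Cyc
    [0,1,7,8,3,2,5,4]]], At 5 [Cyc [0,4,6,1,2,3,7,5], Twin [6,1,0,4,3,2,5,7,8] [6,1,2,3,4,0,5,7,8]]]],
    At 6 [At 4 [At 5 [Cyc [0,1,2,6,3,7,5,4]], At 5 [Cyc [0,4,3,6,2,1,7,5], Twin [5,0,4,3,8,7,1,2,6]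
    [5,4,0,1,7,8,3,2,6]]], At 2 [At 4 [At 5 [Cyc [0,4,3,2,1,7,8,5]]], Cyc [0,1,7,4,3,2,6,5]], At 5 [Cyc
    [0,1,2,6,7,3,4,5], At 2 [Cyc [0,1,3,2,6,7,5,4], Cyc [0,4,8,1,2,6,7,5]], At 2 [Twin
    [5,0,4,3,1,2,6,7,8] [5,4,0,1,3,2,6,7,8], Twin [1,0,5,4,3,2,6,7,8] [1,5,0,4,3,2,6,7,8], Twin
    [0,1,9,4,3,2,6,7,8] [0,5,4,9,1,2,6,7,8]]]]], At 7 [At 4 [At 2 [At 5 [At 6 [Cyc [0,1,2,3,8,7,4,5]]]],
    At 5 [At 2 [At 6 [Join 0 7 (Cyc [0,1,2,3,8,4,5,7]) (Via 1 [At 1 [Cyc [0,1,7,5,4,8,3,2], Cyc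
    [0,3,8,4,6,1,7,5], Cyc [0,4,8,3,2,1,7,5], At 7 [Cyc [0,1,6,4,3,2,7,5], Cyc [0,1,6,4,8,3,7,5], Cyc
    [0,1,2,3,8,4,7,5], Cyc [0,1,2,3,4,6,7,5], Cyc [0,1,2,3,4,8,7,5], Twin [0,1,2,3,8,4,5,7,9]
    [0,5,4,8,3,2,1,7,9]], Cyc [0,5,4,8,3,2,1,6], Cyc [0,5,4,6,1,2,3,8], Cyc [0,5,4,8,3,2,1,9]], At 1
    [Cyc [0,1,7,5,4,8,3,2], Cyc [0,3,8,4,6,1,7,5], Cyc [0,4,8,3,2,1,7,5], At 7 [Cyc [0,1,6,4,3,2,7,5],
    Cyc [0,1,6,4,8,3,7,5], Cyc [0,1,2,3,8,4,7,5], Cyc [0,1,2,3,4,6,7,5], Cyc [0,1,2,3,4,8,7,5], Twin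
    [0,1,2,3,8,4,5,7,9] [0,5,4,8,3,2,1,7,9]], Cyc [0,5,4,8,3,2,1,6], Cyc [0,5,4,6,1,2,3,8], Twin
    [2,3,4,6,1,7,5,0,9] [2,3,8,4,5,7,1,0,9]], At 1 [Cyc [0,1,7,5,4,8,3,2], Cyc [0,3,8,4,6,1,7,5], Cyc
    [0,4,8,3,2,1,7,5], At 7 [Cyc [0,1,6,4,3,2,7,5], Cyc [0,1,6,4,8,3,7,5], Cyc [0,1,2,3,8,4,7,5], Cyc
    [0,1,2,3,4,6,7,5], Cyc [0,1,2,3,4,8,7,5], Twin [0,1,2,3,8,4,5,7,9] [0,5,4,8,3,2,1,7,9]], Cyc
    [0,5,4,8,3,2,1,6], Cyc [0,5,4,6,1,2,3,8], Twin [2,3,4,6,1,7,5,0,9] [2,3,8,4,5,7,1,0,9]], At 1 [Cyc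
    [0,1,7,5,4,8,3,2], Cyc [0,3,8,4,6,1,7,5], Cyc [0,4,8,3,2,1,7,5], At 7 [Cyc [0,1,6,4,3,2,7,5], Cyc
    [0,1,6,4,8,3,7,5], Cyc [0,1,2,3,8,4,7,5], Cyc [0,1,2,3,4,6,7,5], Cyc [0,1,2,3,4,8,7,5], Twin
    [0,1,2,3,8,4,5,7,9] [0,5,4,8,3,2,1,7,9]], Cyc [0,5,4,8,3,2,1,6], Cyc [0,5,4,6,1,2,3,8], Twin
    [2,3,4,6,1,7,5,0,9] [2,3,8,4,5,7,1,0,9]], At 1 [Cyc [0,1,7,5,4,8,3,2], Cyc [0,3,8,4,6,1,7,5], Cyc
    [0,4,8,3,2,1,7,5], At 7 [Cyc [0,1,6,4,3,2,7,5], Cyc [0,1,6,4,8,3,7,5], Cyc [0,1,2,3,8,4,7,5], Cyc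
    [0,1,2,3,4,6,7,5], Cyc [0,1,2,3,4,8,7,5], Cyc [1,2,3,8,4,5,7,9]], Cyc [0,5,4,8,3,2,1,6], Cyc
    [0,5,4,6,1,2,3,8], Twin [2,3,4,6,1,7,5,0,9] [2,3,8,4,5,7,1,0,9]]])]], At 6 [At 2 [Join 0 8 (Twin
    [2,3,4,5,0,8,1,6,7] [2,3,4,5,8,0,1,6,7]) (Via 5 [At 1 [At 7 [Cyc [1,5,8,2,3,4,7,6], Cyc
    [0,1,6,7,4,3,8,5], At 3 [Cyc [0,1,6,7,4,3,2,5], Cyc [1,2,3,5,8,4,7,6], Cyc [0,1,2,3,4,7,6,5], Cyc
    [1,2,3,4,8,5,7,6], Twin [2,3,4,7,6,1,0,5,9] [2,3,4,7,6,1,8,5,9]], Cyc [1,2,3,4,7,6,8,5], Cyc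
    [0,1,2,3,4,7,8,5], Twin [3,2,1,6,7,4,5,8,9] [3,4,7,6,1,0,5,8,9]], Cyc [0,1,6,7,4,3,2,5], Cyc
    [0,3,2,1,6,7,4,5], At 3 [At 7 [Cyc [0,4,7,6,1,2,8,5], Cyc [0,1,6,7,4,3,8,5], Cyc [0,4,3,2,1,6,8,5],
    Cyc [0,1,2,3,4,7,8,5], Twin [2,1,6,7,4,0,5,8,9] [2,3,4,7,6,1,5,8,9]], Cyc [0,1,6,7,4,3,2,5], Cyc
    [0,4,7,6,1,2,3,5], Cyc [0,1,2,3,4,7,6,5], Cyc [0,4,3,2,1,6,7,5], Twin [2,3,4,7,6,1,0,5,9]
    [2,3,4,7,6,1,8,5,9]], Cyc [0,1,2,3,4,7,6,5], Cyc [0,5,4,3,2,1,6,7], Twin [0,9,5,4,3,2,1,6,7]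
    [0,9,5,8,1,2,3,4,7]], At 1 [At 7 [Cyc [0,1,6,7,4,3,2,8,5], Cyc [0,1,6,7,4,3,8,5], At 2 [Cyc
    [0,1,6,7,4,3,2,5], Cyc [1,2,3,5,8,4,7,6], Cyc [0,1,2,3,4,7,6,5], Cyc [1,2,3,4,8,5,7,6], Twin
    [0,5,8,1,2,3,4,7,6] [0,5,9,1,2,3,4,7,6]], Cyc [0,1,2,3,4,7,6,8,5], Cyc [0,1,2,3,4,7,8,5], Twin
    [3,2,1,6,7,4,5,8,9] [3,4,7,6,1,0,5,8,9]], Cyc [0,2,3,4,7,6,1,8,5], Cyc [0,3,2,1,6,7,4,5], At 2 [At 4
    [Cyc [0,1,6,7,4,3,2,5], Cyc [0,4,7,6,1,2,3,5], Cyc [0,1,2,3,4,7,6,5], Cyc [0,4,3,2,1,6,7,5], Twin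
    [2,3,4,7,6,1,0,5,9] [2,3,4,7,6,1,8,5,9]], Cyc [0,1,6,7,4,3,2,5], Cyc [0,4,7,6,1,2,3,5], Cyc
    [0,1,2,3,4,7,6,5], Cyc [0,4,3,2,1,6,7,5], Twin [2,3,4,7,6,1,0,5,9] [2,3,4,7,6,1,8,5,9]], Cyc
    [0,5,8,1,2,3,4,7,6], Cyc [0,5,4,3,2,1,6,7], Twin [3,2,1,6,7,4,5,0,9] [3,4,7,6,1,8,5,0,9]], At 1 [At
    7 [Cyc [0,1,6,7,4,3,2,8,5], Cyc [0,1,6,7,4,3,8,5], At 3 [Cyc [0,1,6,7,4,3,2,5], Cyc
    [1,2,3,5,8,4,7,6], Cyc [0,1,2,3,4,7,6,5], Cyc [1,2,3,4,8,5,7,6], Twin [2,3,4,7,6,1,0,5,9]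
    [2,3,4,7,6,1,8,5,9]], Cyc [0,1,2,3,4,7,6,8,5], Cyc [0,1,2,3,4,7,8,5], Twin [3,2,1,6,7,4,5,8,9]
    [3,4,7,6,1,0,5,8,9]], Cyc [0,2,3,4,7,6,1,8,5], Cyc [0,3,2,1,6,7,4,5], At 3 [At 5 [Cyc
    [0,1,6,7,4,3,2,5], Cyc [0,4,7,6,1,2,3,5], Cyc [0,1,2,3,4,7,6,5], Cyc [0,4,3,2,1,6,7,5], Twin
    [2,3,4,7,6,1,0,5,9] [2,3,4,7,6,1,8,5,9]], Cyc [0,1,6,7,4,3,2,5], Cyc [0,4,7,6,1,2,3,5], Cyc
    [0,1,2,3,4,7,6,5], Cyc [0,4,3,2,1,6,7,5], Twin [2,3,4,7,6,1,0,5,9] [2,3,4,7,6,1,8,5,9]], Cyc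
    [0,5,8,1,2,3,4,7,6], Cyc [0,5,4,3,2,1,6,7], Twin [3,2,1,6,7,4,5,0,9] [3,4,7,6,1,8,5,0,9]], At 1 [At
    7 [Cyc [0,1,6,7,4,3,2,8,5], Cyc [0,1,6,7,4,3,8,5], At 4 [Cyc [0,1,6,7,4,3,2,5], Cyc
    [1,2,3,5,8,4,7,6], Cyc [0,1,2,3,4,7,6,5], Cyc [1,2,3,4,8,5,7,6], Twin [2,3,4,7,6,1,0,5,9]
    [2,3,4,7,6,1,8,5,9]], Cyc [0,1,2,3,4,7,6,8,5], Cyc [0,1,2,3,4,7,8,5], Twin [3,2,1,6,7,4,5,8,9]
    [3,4,7,6,1,0,5,8,9]], Cyc [0,2,3,4,7,6,1,8,5], Cyc [0,3,2,1,6,7,4,5], At 4 [At 6 [Cyc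
    [0,1,6,7,4,3,2,5], Cyc [0,4,7,6,1,2,3,5], Cyc [0,1,2,3,4,7,6,5], Cyc [0,4,3,2,1,6,7,5], Twin
    [2,3,4,7,6,1,0,5,9] [2,3,4,7,6,1,8,5,9]], Cyc [0,1,6,7,4,3,2,5], Cyc [0,4,7,6,1,2,3,5], Cyc
    [0,1,2,3,4,7,6,5], Cyc [0,4,3,2,1,6,7,5], Twin [2,3,4,7,6,1,0,5,9] [2,3,4,7,6,1,8,5,9]], Cyc
    [0,5,8,1,2,3,4,7,6], Cyc [0,5,4,3,2,1,6,7], Twin [3,2,1,6,7,4,5,0,9] [3,4,7,6,1,8,5,0,9]], At 1 [At
    7 [Cyc [0,1,6,7,4,3,2,5], Cyc [0,1,6,7,4,3,8,5], At 5 [Cyc [0,1,6,7,4,3,2,5], Cyc [1,2,3,5,8,4,7,6],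
    Cyc [0,1,2,3,4,7,6,5], Cyc [1,2,3,4,8,5,7,6], Twin [2,3,4,7,6,1,0,5,9] [2,3,4,7,6,1,8,5,9]], Cyc
    [0,1,2,3,4,7,6,5], Cyc [0,1,2,3,4,7,8,5], Twin [2,3,4,7,6,1,0,5,9] [2,3,4,7,6,1,8,5,9]], Cyc
    [0,2,3,4,7,6,1,8,5], Cyc [0,3,2,1,6,7,4,5], At 5 [At 7 [Cyc [0,1,6,7,4,3,2,5], Cyc
    [0,1,6,7,4,3,8,5], Cyc [0,1,2,3,4,7,6,5], Cyc [0,1,2,3,4,7,8,5], Cyc [0,4,3,2,1,8,9,5]], Cyc
    [0,1,6,7,4,3,2,5], Cyc [0,4,7,6,1,2,3,5], Cyc [0,1,2,3,4,7,6,5], Cyc [0,4,3,2,1,6,7,5], Twin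
    [2,3,4,7,6,1,0,5,9] [2,3,4,7,6,1,8,5,9]], Cyc [0,5,8,1,2,3,4,7,6], Cyc [0,5,4,3,2,1,6,7], Twin
    [3,2,1,6,7,4,5,0,9] [3,4,7,6,1,8,5,0,9]]])], Cyc [0,1,6,7,8,3,4,5]]]], At 2 [At 4 [At 5 [At 6 [Cyc
    [0,1,6,7,8,4,3,5]]]], At 4 [At 5 [At 6 [Cyc [0,1,2,3,7,8,4,5]]], At 5 [At 6 [Join 0 6 (Cyc
    [0,1,2,3,8,4,5,6]) (Via 1 [At 1 [Cyc [0,1,6,5,4,8,3,2], Cyc [0,3,8,4,2,1,6,5], Cyc
    [0,4,2,3,7,1,6,5], At 7 [Cyc [0,1,6,2,3,8,4,5], Cyc [0,1,2,4,8,3,6,5], Cyc [0,1,2,3,8,4,6,5], Cyc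
    [0,1,2,4,3,7,6,5], Cyc [0,1,2,3,4,8,6,5], Twin [0,1,2,3,8,4,5,6,9] [0,1,7,3,2,4,5,6,9]], Cyc
    [0,1,6,5,4,2,3,7], Cyc [0,1,6,5,4,2,3,8], Cyc [0,5,4,2,3,7,1,9]], At 1 [Cyc [0,1,6,5,4,8,3,2], Cyc
    [0,3,8,4,2,1,6,5], Cyc [0,4,2,3,7,1,6,5], At 7 [Cyc [0,1,6,2,3,8,4,5], Cyc [0,1,2,4,8,3,6,5], Cyc
    [0,1,2,3,8,4,6,5], Cyc [0,1,2,4,3,7,6,5], Cyc [0,1,2,3,4,8,6,5], Twin [0,1,2,3,8,4,5,6,9]
    [0,1,7,3,2,4,5,6,9]], Cyc [0,1,6,5,4,2,3,7], Cyc [0,1,6,5,4,2,3,8], Twin [2,1,7,3,8,4,5,0,9]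
    [2,3,8,4,5,6,1,0,9]], At 1 [Cyc [0,1,6,5,4,8,3,2], Cyc [0,3,8,4,2,1,6,5], Cyc [0,4,2,3,7,1,6,5], At
    7 [Cyc [0,1,6,2,3,8,4,5], Cyc [0,1,2,4,8,3,6,5], Cyc [0,1,2,3,8,4,6,5], Cyc [0,1,2,4,3,7,6,5], Cyc
    [0,1,2,3,4,8,6,5], Twin [0,1,2,3,8,4,5,6,9] [0,1,7,3,2,4,5,6,9]], Cyc [0,1,6,5,4,2,3,7], Cyc
    [0,1,6,5,4,2,3,8], Twin [2,1,7,3,8,4,5,0,9] [2,3,8,4,5,6,1,0,9]], At 1 [Cyc [0,1,6,5,4,8,3,2], Cyc
    [0,3,8,4,2,1,6,5], Cyc [0,4,2,3,7,1,6,5], At 7 [Cyc [0,1,6,2,3,8,4,5], Cyc [0,1,2,4,8,3,6,5], Cyc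
    [0,1,2,3,8,4,6,5], Cyc [0,1,2,4,3,7,6,5], Cyc [0,1,2,3,4,8,6,5], Twin [0,1,2,3,8,4,5,6,9]
    [0,1,7,3,2,4,5,6,9]], Cyc [0,1,6,5,4,2,3,7], Cyc [0,1,6,5,4,2,3,8], Twin [2,1,7,3,8,4,5,0,9]
    [2,3,8,4,5,6,1,0,9]], At 1 [Cyc [0,1,6,5,4,8,3,2], Cyc [0,3,8,4,2,1,6,5], Cyc [0,4,2,3,7,1,6,5], At
    7 [Cyc [0,1,6,2,3,8,4,5], Cyc [0,1,2,4,8,3,6,5], Cyc [0,1,2,3,8,4,6,5], Cyc [0,1,2,4,3,7,6,5], Cyc
    [0,1,2,3,4,8,6,5], Cyc [1,2,3,8,4,5,6,9]], Cyc [0,1,6,5,4,2,3,7], Cyc [0,1,6,5,4,2,3,8], Twin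
    [2,1,7,3,8,4,5,0,9] [2,3,8,4,5,6,1,0,9]]])], At 6 [Cyc [0,1,7,8,3,2,4,5], Twin [0,5,4,9,8,7,1,2,3]
    [0,5,6,1,7,8,9,4,3]]]]], At 6 [At 2 [At 4 [At 5 [Twin [0,5,4,1,7,8,3,2,6] [0,5,4,3,8,7,1,2,6]]], At
    4 [At 5 [Cyc [0,1,2,6,3,8,4,5]], At 5 [Join 1 6 (Twin [0,5,7,1,2,6,3,4,8] [0,5,7,1,6,2,3,4,8]) (Via
    2 [At 1 [Cyc [0,1,7,5,4,3,6,2], At 3 [Cyc [0,1,7,5,4,3,6,2], Twin [0,5,7,1,2,6,3,4,8]
    [0,5,7,1,3,6,2,4,8], Cyc [0,1,8,4,3,6,2,5], Like 0, Cyc [0,1,3,6,2,8,4,5], Twin [0,1,7,5,4,3,6,2,9]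
    [0,5,4,8,1,3,6,2,9]], Twin [0,5,7,1,8,4,2,3,6] [0,5,7,1,8,4,3,2,6], Cyc [0,1,8,4,3,6,2,5], Like 0,
    Cyc [0,1,8,2,6,3,4,5], Cyc [0,1,9,2,6,3,4,5]], At 2 [Cyc [0,1,7,5,4,3,6,2], At 4 [Cyc
    [0,1,7,5,4,3,6,2], Twin [0,5,7,1,8,4,2,3,6] [0,5,7,1,8,4,3,2,6], Cyc [0,1,8,4,3,6,2,5], Like 0, Cyc
    [0,1,8,2,6,3,4,5], Twin [0,1,7,5,4,3,6,2,9] [0,5,7,1,8,4,3,2,9]], Twin [0,5,7,1,8,4,2,3,6]
    [0,5,7,1,8,4,3,2,6], Cyc [0,1,8,4,3,6,2,5], Like 0, Cyc [0,1,8,2,6,3,4,5], Twin [0,1,7,5,4,3,6,2,9]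
    [0,5,7,1,8,4,3,2,9]], At 3 [Cyc [0,1,7,5,4,3,6,2], At 5 [Cyc [0,1,7,5,4,3,6,2], Twin
    [0,5,7,1,8,4,2,3,6] [0,5,7,1,8,4,3,2,6], Cyc [0,1,8,4,3,6,2,5], Like 0, Cyc [0,1,8,2,6,3,4,5], Twin
    [0,1,7,5,4,3,6,2,9] [0,5,7,1,8,4,3,2,9]], Twin [0,5,7,1,8,4,2,3,6] [0,5,7,1,8,4,3,2,6], Cyc
    [0,1,8,4,3,6,2,5], Like 0, Cyc [0,1,8,2,6,3,4,5], Twin [0,1,7,5,4,3,6,2,9] [0,5,7,1,8,4,3,2,9]], At
    4 [Cyc [0,1,7,5,4,3,6,2], At 6 [Cyc [0,1,7,5,4,3,6,2], Twin [0,5,7,1,8,4,2,3,6] [0,5,7,1,8,4,3,2,6],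
    Cyc [0,1,8,4,3,6,2,5], Like 0, Cyc [0,1,8,2,6,3,4,5], Twin [0,1,7,5,4,3,6,2,9] [0,5,7,1,8,4,3,2,9]],
    Twin [0,5,7,1,8,4,2,3,6] [0,5,7,1,8,4,3,2,6], Cyc [0,1,8,4,3,6,2,5], Like 0, Cyc [0,1,8,2,6,3,4,5],
    Twin [0,1,7,5,4,3,6,2,9] [0,5,7,1,8,4,3,2,9]], At 5 [Cyc [0,1,7,5,4,3,6,2], At 7 [Cyc
    [0,1,7,5,4,3,2,6], Twin [0,5,7,1,2,3,6,4,8] [0,5,7,1,2,6,3,4,8], Cyc [0,1,8,4,3,2,6,5], Like 0, Cyc
    [0,1,2,3,6,8,4,5], Cyc [0,1,2,9,6,3,4,5]], Twin [0,5,7,1,8,4,2,3,6] [0,5,7,1,8,4,3,2,6], Cyc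
    [0,1,8,4,3,6,2,5], Like 0, Cyc [0,1,8,2,6,3,4,5], Twin [0,1,7,5,4,3,6,2,9] [0,5,7,1,8,4,3,2,9]]]),
    Twin [0,5,4,3,9,8,1,2,6] [0,5,7,1,8,9,3,2,6]]]], At 2 [At 4 [At 5 [Cyc [0,1,7,8,4,6,2,3,5]]], At 4
    [At 5 [Twin [0,1,7,5,4,8,3,2,6] [0,5,7,1,2,3,8,4,6]], At 5 [Cyc [0,1,8,3,2,6,4,5], Twin
    [0,5,7,1,2,3,4,9,8] [0,5,7,1,2,6,4,9,8]]]], At 5 [Cyc [0,1,2,6,7,3,4,5], At 2 [Cyc
    [0,1,2,6,7,4,3,5], Twin [0,1,8,5,4,7,6,2,3] [0,5,8,1,2,6,7,4,3]], At 4 [Cyc [0,1,2,6,7,8,3,4,5], Cyc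
    [0,1,2,6,7,8,4,5], Cyc [0,1,9,8,7,6,2,3,4,5]]]]], At 2 [At 7 [At 4 [At 5 [At 6 [Cyc
    [0,1,2,3,4,8,7,5]]], At 5 [Cyc [0,1,7,5,4,2,3,6], Twin [5,0,6,3,4,2,1,7,8] [5,4,2,3,6,0,1,7,8]]], At
    4 [At 5 [At 6 [Cyc [0,1,2,3,4,7,8,5]]], At 5 [Cyc [0,1,7,4,5,2,3,6], Twin [4,3,6,0,5,2,1,7,8]
    [4,5,0,6,3,2,1,7,8]]], At 6 [Cyc [0,5,4,7,2,1,3,6], Cyc [0,1,2,7,5,4,3,6], Twin [6,0,5,4,3,1,2,7,8]
    [6,3,4,5,0,1,2,7,8]]], At 4 [At 5 [At 6 [At 7 [Cyc [0,1,2,8,7,5,4,6]]], At 6 [Cyc [0,1,2,3,7,5,4,6],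
    Twin [5,0,6,4,1,2,3,7,8] [5,4,6,0,1,2,3,7,8]]], At 5 [At 6 [At 7 [Cyc [0,1,2,8,7,3,4,5]]], At 6 [Cyc
    [0,1,2,3,7,5,4,6], Twin [3,2,1,0,6,4,5,7,8] [3,2,1,4,6,0,5,7,8]]], At 5 [At 7 [Cyc
    [0,1,7,3,2,5,4,6], Twin [5,0,6,4,1,7,3,2,8] [5,0,6,4,3,7,1,2,8]], Cyc [0,5,7,1,2,3,4,6], At 6 [Twin
    [2,1,7,8,3,4,5,0,6] [2,3,8,7,1,0,5,4,6], Cyc [0,5,8,7,1,2,3,4,6], Twin [0,5,4,3,2,1,7,8,9]
    [0,6,4,3,2,1,7,8,9]]]], At 7 [At 4 [At 5 [At 6 [Cyc [0,1,2,3,8,7,4,5]]], At 5 [At 6 [Cyc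
    [0,1,2,3,8,4,5,6]], At 6 [Twin [2,3,4,8,7,1,0,5,6] [2,3,4,8,7,1,5,0,6], Cyc [0,1,7,8,9,3,4,5]]]], At
    6 [At 4 [At 5 [Cyc [0,1,7,8,3,2,4,5]]], At 5 [Cyc [0,1,2,3,7,4,5,6], Twin [6,0,5,1,2,3,4,7,8]
    [6,5,0,1,2,3,4,7,8]]], At 6 [Cyc [0,1,2,7,3,4,5,6], At 4 [Cyc [0,1,3,2,7,4,5,6], At 5 [Cyc
    [0,1,8,3,2,7,4,5], Twin [0,6,5,1,2,3,4,9,8] [0,6,5,1,2,7,4,9,8]]], At 5 [Cyc [0,1,2,7,8,3,4,5], Cyc
    [0,1,2,7,8,4,5,6], Twin [0,1,5,4,3,2,7,8,9] [0,6,5,4,3,2,7,8,9]]]], Cyc [0,5,4,3,2,1,7,6]]]"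

definition hexagon_tree_4 :: search where
  "hexagon_tree_4 =
    At 1 [At 7 [At 2 [At 3 [At 5 [At 6 [Cyc [0,1,7,8,4,2,3,5]]]], At 3 [At 5 [At 6 [Cyc
    [0,1,7,8,4,3,6,5]]], Cyc [0,1,7,6,3,2,4,5]]], At 2 [At 3 [At 5 [At 6 [Cyc [0,3,4,6,1,7,8,5]]]], At 3
    [At 5 [At 6 [Cyc [0,1,7,8,5,4,6,3]]], At 5 [At 6 [Cyc [0,1,7,6,3,4,8,5]], At 6 [Cyc
    [0,3,6,7,1,8,4,5], Cyc [0,3,6,7,1,8,9,5]]]]], At 6 [At 2 [At 3 [Cyc [0,1,7,5,4,6,2,3]], At 3 [Cyc
    [0,1,2,6,4,3,7,5], Cyc [0,1,8,7,3,2,6,4,5]]], At 2 [At 3 [Cyc [0,1,7,4,3,2,6,5]], At 3 [Cyc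
    [0,1,2,6,5,4,7,3], Cyc [0,1,8,7,3,2,6,5]]], At 5 [At 2 [Cyc [0,1,2,6,7,4,3,5], Twin
    [1,0,5,4,7,6,2,3,8] [1,2,6,7,4,5,0,3,8]], Cyc [0,1,2,6,7,5,4,3], Cyc [0,1,8,7,6,2,3,4,5]]]], At 7
    [At 2 [At 3 [At 5 [At 6 [Cyc [0,4,3,8,7,1,6,5]]]], At 3 [At 5 [At 6 [Cyc [0,1,7,8,3,4,6,5]]], At 6
    [Cyc [0,4,6,7,1,2,3,5], At 5 [Cyc [0,1,7,6,4,3,8,5], Twin [5,0,1,7,6,4,3,8,9]
    [5,4,6,7,1,2,3,8,9]]]]], At 2 [At 3 [At 5 [At 6 [Cyc [0,1,7,8,5,2,3,4]]]], At 3 [At 5 [At 6 [Cyc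
    [0,1,7,8,5,2,3,4]]], Cyc [0,1,7,6,4,3,2,5]]], At 6 [At 2 [At 3 [Cyc [0,4,3,6,2,1,7,5]], At 3 [Cyc
    [0,1,2,6,3,4,7,5], Twin [5,0,1,8,7,4,3,2,6] [5,0,4,7,8,1,2,3,6]]], At 5 [At 2 [At 3 [Cyc
    [0,4,7,8,1,2,3,5]]], Cyc [0,1,7,5,6,2,3,4]], At 5 [Cyc [0,1,2,6,7,3,4,5], Cyc [0,1,5,7,6,2,3,4], Cyc
    [0,1,8,7,6,2,3,4]]]], At 7 [At 2 [At 3 [At 5 [At 6 [Join 2 8 (Cyc [0,1,7,8,2,3,4,5]) (Via 3 [At 1
    [Cyc [0,2,1,7,8,3,4,5], At 7 [Cyc [0,5,4,3,2,1,7,8], At 3 [Cyc [0,3,2,1,7,8,4,5], Twin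
    [0,5,3,2,1,6,4,8,7] [0,5,4,6,1,2,3,8,7], Cyc [0,1,7,8,3,6,4,5], Cyc [0,1,2,3,7,8,4,5], Twin
    [0,5,4,6,1,7,8,3,9] [0,5,4,8,7,1,2,3,9]], Twin [0,5,4,6,1,7,8,3,2] [0,5,8,7,1,6,4,3,2], Cyc
    [0,1,2,3,8,6,4,5], At 6 [Cyc [0,5,4,6,1,3,8,7], Cyc [0,1,2,3,8,7,4,5], Cyc [0,1,6,4,3,8,7,5], Cyc
    [0,1,3,8,7,6,4,5], Twin [5,0,1,6,4,3,8,7,9] [5,4,6,1,2,3,8,7,9]], Twin [0,5,4,3,2,1,7,8,9]
    [0,5,4,6,1,2,3,8,9]], Cyc [0,1,7,8,3,2,4,5], Cyc [1,6,4,5,2,3,8,7], Cyc [0,1,7,8,3,6,4,5], Cyc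
    [0,1,2,7,8,3,4,5], Twin [0,5,4,3,9,2,1,7,8] [0,5,4,6,1,2,9,3,8]], At 1 [Cyc [0,2,1,7,8,3,4,5], At 7
    [Cyc [0,5,4,3,2,1,7,8], At 2 [Cyc [0,3,2,1,7,8,4,5], Twin [0,5,3,2,1,6,4,8,7] [0,5,4,6,1,2,3,8,7],
    Cyc [0,1,7,8,3,6,4,5], Cyc [0,1,2,3,7,8,4,5], Twin [0,5,4,6,1,2,3,8,7] [0,5,4,6,1,9,3,8,7]], Twin
    [0,5,4,6,1,7,8,3,2] [0,5,8,7,1,6,4,3,2], Cyc [0,1,2,3,8,6,4,5], At 6 [Cyc [0,5,4,6,1,2,3,8,7], Cyc
    [0,1,2,3,8,7,4,5], Cyc [0,1,6,4,3,8,7,5], Cyc [0,1,6,7,8,3,4,5], Twin [5,0,1,6,4,3,8,7,9]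
    [5,4,6,1,2,3,8,7,9]], Twin [0,5,4,3,2,1,7,8,9] [0,5,4,6,1,2,3,8,9]], Cyc [0,1,7,8,3,2,4,5], Cyc
    [1,6,4,5,2,3,8,7], Cyc [0,1,7,8,3,2,6,4,5], Cyc [0,1,2,7,8,3,4,5], At 2 [Cyc [0,3,8,7,1,6,4,5], Twin
    [0,5,4,3,8,7,1,9,2] [0,5,4,6,1,7,8,3,2], Cyc [1,6,4,9,2,3,8,7], Cyc [0,1,6,4,3,2,9,5], Cyc
    [0,1,2,9,6,3,4,5], Cyc [0,1,2,9,7,3,4,5], Cyc [0,1,2,9,10,3,4,5]]], At 1 [Cyc [0,2,1,7,8,3,4,5], At
    7 [Cyc [0,5,4,3,2,1,7,8], At 3 [Cyc [0,3,2,1,7,8,4,5], Twin [0,5,3,2,1,6,4,8,7] [0,5,4,6,1,2,3,8,7],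
    Cyc [0,1,7,8,3,6,4,5], Cyc [0,1,2,3,7,8,4,5], Twin [0,5,4,6,1,7,8,3,9] [0,5,4,8,7,1,2,3,9]], Twin
    [0,5,4,6,1,7,8,3,2] [0,5,8,7,1,6,4,3,2], Cyc [0,1,2,3,8,6,4,5], At 6 [Cyc [0,5,4,6,1,2,3,8,7], Cyc
    [0,1,2,3,8,7,4,5], Cyc [0,1,6,4,3,8,7,5], Cyc [0,1,6,7,8,3,4,5], Twin [5,0,1,6,4,3,8,7,9]
    [5,4,6,1,2,3,8,7,9]], Twin [0,5,4,3,2,1,7,8,9] [0,5,4,6,1,2,3,8,9]], Cyc [0,1,7,8,3,2,4,5], Cyc
    [1,6,4,5,2,3,8,7], Cyc [0,1,7,8,3,2,6,4,5], Cyc [0,1,2,7,8,3,4,5], At 2 [Cyc [0,5,4,3,8,7,1,2,9],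
    Twin [0,5,4,3,8,7,1,9,2] [0,5,4,6,1,7,8,3,2], Cyc [1,6,4,9,2,3,8,7], Cyc [0,1,6,4,3,2,9,5], Cyc
    [0,1,6,9,2,3,4,5], Cyc [0,1,7,9,2,3,4,5], Twin [5,0,1,6,4,3,2,9,10] [5,0,1,7,8,3,2,9,10]]], At 1
    [Cyc [0,2,1,7,8,3,4,5], At 7 [Cyc [0,5,4,3,2,1,7,8], At 4 [Cyc [0,3,2,1,7,8,4,5], Twin
    [0,5,3,2,1,6,4,8,7] [0,5,4,6,1,2,3,8,7], Cyc [0,1,7,8,3,6,4,5], Cyc [0,1,2,3,7,8,4,5], Twin
    [0,5,4,6,1,7,8,3,9] [0,5,4,8,7,1,2,3,9]], Twin [0,5,4,6,1,7,8,3,2] [0,5,8,7,1,6,4,3,2], Cyc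
    [0,1,2,3,8,6,4,5], At 6 [Cyc [0,3,8,7,1,6,4,5], Cyc [0,1,2,3,8,7,4,5], Cyc [0,1,6,4,3,8,7,5], Cyc
    [0,1,6,7,8,3,4,5], Twin [0,5,4,6,1,2,3,8,7] [0,5,4,6,1,2,3,9,7]], Twin [0,5,4,3,2,1,7,8,9]
    [0,5,4,6,1,2,3,8,9]], Cyc [0,1,7,8,3,2,4,5], Cyc [1,6,4,5,2,3,8,7], Cyc [0,1,7,8,3,2,6,4,5], Cyc
    [0,1,2,7,8,3,4,5], At 2 [Cyc [0,5,4,3,8,7,1,2,9], Twin [0,5,4,3,8,7,1,9,2] [0,5,4,6,1,7,8,3,2], Cyc
    [1,6,4,9,2,3,8,7], Cyc [0,1,6,4,3,2,9,5], Cyc [0,1,6,9,2,3,4,5], Cyc [0,1,7,9,2,3,4,5], Twin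
    [5,0,1,6,4,3,2,9,10] [5,0,1,7,8,3,2,9,10]]], At 1 [Cyc [0,2,1,7,8,3,4,5], At 7 [Cyc
    [0,3,8,7,1,6,4,5], At 5 [Cyc [0,3,2,1,7,8,4,5], Twin [0,5,3,2,1,6,4,8,7] [0,5,4,6,1,2,3,8,7], Cyc
    [0,1,7,8,3,6,4,5], Cyc [0,1,2,3,7,8,4,5], Twin [0,5,4,6,1,7,8,3,9] [0,5,4,8,7,1,2,3,9]], Twin
    [0,5,4,6,1,7,8,3,2] [0,5,8,7,1,6,4,3,2], Cyc [0,1,2,3,8,6,4,5], At 5 [Cyc [0,3,8,7,1,6,4,5], At 4
    [At 3 [At 2 [Cyc [0,1,7,8,3,4,6,5], Cyc [0,4,3,8,7,1,9,5]], Cyc [0,5,4,3,8,7,1,6], Twin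
    [2,1,7,8,3,4,5,0,9] [2,3,7,1,6,4,5,0,9]], At 3 [At 2 [Cyc [0,5,4,3,8,7,1,6], Cyc [0,5,4,3,8,7,1,9]],
    Cyc [0,1,7,8,3,4,6,5], Twin [7,8,3,2,1,6,4,5,9] [7,8,3,4,6,1,0,5,9]], At 3 [Cyc [0,5,4,3,8,7,1,6],
    Cyc [0,1,7,8,3,4,6,5], Twin [7,3,2,1,0,5,4,6,9] [7,8,3,4,5,0,1,6,9]], At 3 [Twin [0,5,4,6,1,2,3,7,8]
    [0,9,4,6,1,2,3,7,8], Cyc [0,1,7,8,3,4,9,5], Twin [0,5,4,6,1,2,3,8,7] [0,5,4,9,6,1,2,3,7], Twin
    [2,3,7,1,0,5,4,9,10] [2,3,8,7,1,6,4,9,10]]], At 4 [At 3 [Cyc [0,4,6,1,7,8,3,5], Cyc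
    [0,1,7,8,3,5,4,6], Twin [2,1,7,8,3,4,5,0,9] [2,3,7,1,6,4,5,0,9]], At 3 [Cyc [0,4,6,1,7,8,3,5], At 2
    [Cyc [0,1,7,8,3,5,4,6], Cyc [1,7,8,3,5,4,6,9]], Twin [7,8,3,2,1,0,5,4,9] [7,8,3,5,0,1,6,4,9]], Cyc
    [0,1,7,8,3,4,6,5], Twin [7,8,3,2,1,6,4,5,9] [7,8,3,4,6,1,0,5,9]], Cyc [0,1,7,8,3,6,4,5], At 4 [Cyc
    [0,5,4,6,1,2,3,9], Cyc [0,1,7,8,3,9,4,5], Cyc [1,6,4,5,9,3,8,7], Cyc [0,1,2,3,9,6,4,5], Twin
    [0,5,4,6,1,2,3,9,10] [0,5,4,6,1,7,3,9,10]]], Cyc [0,1,7,8,9,3,4,5]], Cyc [0,1,7,8,3,2,4,5], Cyc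
    [1,6,4,5,2,3,8,7], Cyc [0,1,7,8,3,2,6,4,5], Cyc [0,1,2,7,8,3,4,5], At 2 [Cyc [0,5,4,3,8,7,1,2,9],
    Twin [0,5,4,3,8,7,1,9,2] [0,5,4,6,1,7,8,3,2], Cyc [1,6,4,9,2,3,8,7], Cyc [0,1,6,4,3,2,9,5], Cyc
    [0,1,6,9,2,3,4,5], Cyc [0,1,7,9,2,3,4,5], Twin [5,0,1,6,4,3,2,9,10] [5,0,1,7,8,3,2,9,10]]]])]]], At
    3 [At 5 [At 6 [Cyc [0,1,7,8,3,4,6,5]]], At 5 [At 6 [Cyc [1,2,3,8,4,5,6,7]], At 6 [Join 0 6 (Cyc
    [0,5,4,3,2,1,7,6]) (Via 5 [At 1 [At 7 [Cyc [0,1,7,6,2,3,4,5], Twin [0,5,4,8,1,7,6,3,2]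
    [0,5,6,7,1,8,4,3,2], At 3 [Cyc [0,1,7,6,4,3,2,5], Twin [0,5,3,2,1,7,6,4,8] [0,5,6,7,1,2,3,4,8], Cyc
    [0,1,2,3,4,6,7,5], Cyc [1,2,3,4,8,5,6,7], Twin [2,3,4,6,7,1,0,5,9] [2,3,4,8,1,7,6,5,9]], At 6 [Cyc
    [1,5,6,7,2,3,4,8], Cyc [0,1,8,4,3,7,6,5], Cyc [0,1,2,3,4,7,6,5], Cyc [1,2,3,4,5,6,7,8], Twin
    [3,2,1,8,4,5,6,7,9] [3,4,8,1,0,5,6,7,9]], Cyc [0,1,2,3,4,8,6,5], Twin [2,3,4,5,0,1,7,6,9]
    [2,3,4,8,1,0,5,6,9]], Cyc [0,1,7,6,5,4,3,2], Cyc [0,3,4,8,1,7,6,5], Cyc [0,4,3,2,1,7,6,5], Cyc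
    [0,1,2,3,4,5,6,7], Cyc [1,2,3,4,8,5,6,7], Twin [2,3,4,5,9,0,1,7,6] [2,3,4,8,1,0,9,5,6]], At 1 [At 7
    [Cyc [0,1,7,6,2,3,4,5], Twin [0,5,4,8,1,7,6,3,2] [0,5,6,7,1,8,4,3,2], At 2 [Cyc [0,1,7,6,4,3,2,5],
    Twin [0,5,3,2,1,7,6,4,8] [0,5,6,7,1,2,3,4,8], Cyc [0,1,2,3,4,6,7,5], Cyc [1,2,3,4,8,5,6,7], Twin
    [0,5,6,7,1,8,4,3,2] [0,5,9,1,7,6,4,3,2]], At 6 [Cyc [0,1,8,4,3,2,7,6,5], Cyc [0,1,8,4,3,7,6,5], Cyc
    [0,1,2,3,4,7,6,5], Cyc [1,2,3,4,5,6,7,8], Twin [3,2,1,8,4,5,6,7,9] [3,4,8,1,0,5,6,7,9]], Cyc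
    [0,1,2,3,4,8,6,5], Twin [2,3,4,5,0,1,7,6,9] [2,3,4,8,1,0,5,6,9]], Cyc [0,1,7,6,5,4,3,2], Cyc
    [0,3,4,8,1,7,6,5], Cyc [0,4,3,2,1,7,6,5], Cyc [0,1,2,3,4,5,6,7], Cyc [0,5,6,7,1,2,3,4,8], At 2 [Twin
    [0,5,6,7,1,8,4,3,2] [0,9,1,7,6,5,4,3,2], Cyc [1,7,6,5,2,3,4,8], Cyc [0,1,7,6,5,4,3,9], Cyc
    [0,5,6,7,1,8,4,9], Cyc [0,1,2,3,4,5,7,9], Cyc [0,1,2,3,4,5,8,9], Cyc [0,1,2,3,4,5,10,9]]], At 1 [At
    7 [Cyc [0,1,7,6,2,3,4,5], Twin [0,5,4,8,1,7,6,3,2] [0,5,6,7,1,8,4,3,2], At 3 [Cyc [0,1,7,6,4,3,2,5],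
    Twin [0,5,3,2,1,7,6,4,8] [0,5,6,7,1,2,3,4,8], Cyc [0,1,2,3,4,6,7,5], Cyc [1,2,3,4,8,5,6,7], Twin
    [2,3,4,6,7,1,0,5,9] [2,3,4,8,1,7,6,5,9]], At 6 [Cyc [0,1,8,4,3,2,7,6,5], Cyc [0,1,8,4,3,7,6,5], Cyc
    [0,1,2,3,4,7,6,5], Cyc [1,2,3,4,5,6,7,8], Twin [3,2,1,8,4,5,6,7,9] [3,4,8,1,0,5,6,7,9]], Cyc
    [0,1,2,3,4,8,6,5], Twin [2,3,4,5,0,1,7,6,9] [2,3,4,8,1,0,5,6,9]], Cyc [0,1,7,6,5,4,3,2], Cyc
    [0,3,4,8,1,7,6,5], Cyc [0,4,3,2,1,7,6,5], Cyc [0,1,2,3,4,5,6,7], Cyc [0,5,6,7,1,2,3,4,8], At 2 [Twin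
    [0,5,6,7,1,8,4,3,2] [0,9,1,7,6,5,4,3,2], Cyc [0,1,7,6,5,4,3,2,9], Cyc [0,1,7,6,5,4,3,9], Cyc
    [0,5,6,7,1,8,4,9], Cyc [0,1,8,4,5,6,7,9], Cyc [0,1,7,6,5,4,8,9], Twin [3,2,1,7,6,5,0,9,10]
    [3,2,1,8,4,5,0,9,10]]], At 1 [At 7 [Cyc [0,1,7,6,2,3,4,5], Twin [0,5,4,8,1,7,6,3,2]
    [0,5,6,7,1,8,4,3,2], At 4 [Cyc [0,1,7,6,4,3,2,5], Twin [0,5,3,2,1,7,6,4,8] [0,5,6,7,1,2,3,4,8], Cyc
    [0,1,2,3,4,6,7,5], Cyc [1,2,3,4,8,5,6,7], Twin [2,3,4,6,7,1,0,5,9] [2,3,4,8,1,7,6,5,9]], At 6 [Cyc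
    [1,7,6,5,2,3,4,8], Cyc [0,1,8,4,3,7,6,5], Cyc [0,1,2,3,4,7,6,5], Cyc [1,2,3,4,5,6,7,8], Twin
    [0,5,6,7,1,2,3,4,8] [0,5,9,7,1,2,3,4,8]], Cyc [0,1,2,3,4,8,6,5], Twin [2,3,4,5,0,1,7,6,9]
    [2,3,4,8,1,0,5,6,9]], Cyc [0,1,7,6,5,4,3,2], Cyc [0,3,4,8,1,7,6,5], Cyc [0,4,3,2,1,7,6,5], Cyc
    [0,1,2,3,4,5,6,7], Cyc [0,5,6,7,1,2,3,4,8], At 2 [Twin [0,5,6,7,1,8,4,3,2] [0,9,1,7,6,5,4,3,2], Cyc
    [0,1,7,6,5,4,3,2,9], Cyc [0,1,7,6,5,4,3,9], Cyc [0,5,6,7,1,8,4,9], Cyc [0,1,8,4,5,6,7,9], Cyc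
    [0,1,7,6,5,4,8,9], Twin [3,2,1,7,6,5,0,9,10] [3,2,1,8,4,5,0,9,10]]], At 1 [At 7 [Cyc
    [0,1,7,6,2,3,4,5], Twin [0,5,4,8,1,7,6,3,2] [0,5,6,7,1,8,4,3,2], At 5 [Cyc [0,1,7,6,4,3,2,5], Twin
    [0,5,3,2,1,7,6,4,8] [0,5,6,7,1,2,3,4,8], Cyc [0,1,2,3,4,6,7,5], Cyc [1,2,3,4,8,5,6,7], Twin
    [2,3,4,6,7,1,0,5,9] [2,3,4,8,1,7,6,5,9]], At 5 [Cyc [1,7,6,5,2,3,4,8], At 4 [At 3 [Cyc
    [1,7,6,5,3,2,4,8], Cyc [1,2,8,4,3,5,6,7], Twin [0,1,7,6,5,4,3,2,9] [0,5,7,1,8,4,3,2,9]], At 3 [Cyc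
    [1,7,6,5,3,2,4,8], At 2 [Cyc [1,2,8,4,3,5,6,7], Cyc [1,7,6,5,3,4,8,9]], Twin [6,7,5,0,1,2,3,4,9]
    [6,7,5,3,2,1,8,4,9]], Cyc [1,2,3,8,4,5,6,7], Twin [6,7,5,0,1,8,4,3,9] [6,7,5,4,8,1,2,3,9]], At 4 [At
    3 [At 2 [Cyc [1,2,3,8,4,5,6,7], Cyc [1,7,6,5,4,2,3,9]], Cyc [1,7,6,5,4,3,2,8], Twin
    [0,1,7,6,5,4,3,2,9] [0,5,6,7,1,8,4,2,9]], At 3 [At 2 [Cyc [1,7,6,5,4,3,2,8], Cyc [1,7,6,5,4,3,2,9]],
    Cyc [1,2,3,8,4,5,6,7], Twin [6,7,5,0,1,8,4,3,9] [6,7,5,4,8,1,2,3,9]], At 3 [Cyc [1,7,6,5,4,3,2,8],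
    Cyc [1,2,3,8,4,5,6,7], Twin [6,5,0,1,2,3,4,8,9] [6,5,7,1,2,3,4,8,9]], At 3 [Twin [0,1,7,6,5,4,3,2,9]
    [0,5,6,7,1,2,3,4,9], Cyc [1,2,3,9,4,5,6,7], Twin [0,5,6,7,1,2,3,4,9] [0,5,7,1,2,3,4,8,9], Twin
    [0,5,6,7,1,8,4,9,10] [0,5,7,1,2,3,4,9,10]]], Cyc [1,2,3,4,8,5,6,7], At 4 [Cyc [0,1,8,4,3,2,9,5], Cyc
    [1,7,6,5,9,3,4,8], Cyc [1,2,3,4,9,5,6,7], Cyc [0,1,2,3,4,8,9,5], Twin [2,3,4,8,1,0,5,9,10]
    [2,3,4,8,1,7,5,9,10]]], Cyc [0,1,2,3,4,8,6,5], Cyc [1,2,3,4,5,9,6,7]], Cyc [0,1,7,6,5,4,3,2], Cyc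
    [0,3,4,8,1,7,6,5], Cyc [0,4,3,2,1,7,6,5], Cyc [0,1,2,3,4,5,6,7], Cyc [0,5,6,7,1,2,3,4,8], At 2 [Twin
    [0,5,6,7,1,8,4,3,2] [0,9,1,7,6,5,4,3,2], Cyc [0,1,7,6,5,4,3,2,9], Cyc [0,1,7,6,5,4,3,9], Cyc
    [0,5,6,7,1,8,4,9], Cyc [0,1,8,4,5,6,7,9], Cyc [0,1,7,6,5,4,8,9], Twin [3,2,1,7,6,5,0,9,10]
    [3,2,1,8,4,5,0,9,10]]]]), Cyc [1,7,6,5,4,3,9,8]]]]], At 2 [At 3 [At 5 [At 6 [Cyc
    [0,1,7,8,4,2,3,5]]]], At 3 [At 5 [At 6 [Cyc [0,1,7,8,4,3,6,5]]], At 5 [At 6 [Cyc [1,2,3,8,4,5,6,7]],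
    At 6 [Cyc [1,7,6,5,4,2,3,8], Twin [3,2,1,8,9,4,5,6,7] [3,4,9,8,1,0,5,6,7]]]]], At 6 [At 2 [At 3 [At
    5 [Join 1 6 (Twin [0,5,4,7,1,2,6,3,8] [0,5,4,7,1,6,2,3,8]) (Via 2 [At 1 [Cyc [0,2,3,8,1,7,4,5], At 3
    [Cyc [0,2,3,8,1,7,4,5], Cyc [0,1,8,3,6,2,4,5], Cyc [0,1,7,4,3,6,2,5], Cyc [0,1,3,6,2,7,4,5], Cyc
    [0,1,8,2,6,3,4,5], Twin [0,5,4,7,1,3,6,2,9] [0,5,4,7,1,8,3,2,9]], Cyc [0,1,8,3,6,2,4,5], Cyc
    [0,1,7,4,3,6,2,5], Cyc [0,1,7,2,6,3,4,5], Cyc [0,1,8,2,6,3,4,5], Cyc [0,1,9,2,6,3,4,5]], At 2 [Cyc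
    [0,2,3,8,1,7,4,5], At 4 [Cyc [0,2,3,8,1,7,4,5], Cyc [0,1,8,3,6,2,4,5], Cyc [0,1,7,4,3,6,2,5], Cyc
    [0,1,7,2,6,3,4,5], Cyc [0,1,8,2,6,3,4,5], Twin [5,0,1,7,4,3,6,2,9] [5,4,7,1,8,3,6,2,9]], Cyc
    [0,1,8,3,6,2,4,5], Cyc [0,1,7,4,3,6,2,5], Cyc [0,1,7,2,6,3,4,5], Cyc [0,1,8,2,6,3,4,5], Twin
    [5,0,1,7,4,3,6,2,9] [5,4,7,1,8,3,6,2,9]], At 3 [Cyc [0,2,3,8,1,7,4,5], At 5 [Cyc [0,2,3,8,1,7,4,5],
    Cyc [0,1,8,3,6,2,4,5], Cyc [0,1,7,4,3,6,2,5], Cyc [0,1,7,2,6,3,4,5], Cyc [0,1,8,2,6,3,4,5], Twin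
    [5,0,1,7,4,3,6,2,9] [5,4,7,1,8,3,6,2,9]], Cyc [0,1,8,3,6,2,4,5], Cyc [0,1,7,4,3,6,2,5], Cyc
    [0,1,7,2,6,3,4,5], Cyc [0,1,8,2,6,3,4,5], Twin [5,0,1,7,4,3,6,2,9] [5,4,7,1,8,3,6,2,9]], At 4 [Cyc
    [0,2,3,8,1,7,4,5], At 6 [Cyc [0,2,3,8,1,7,4,5], Cyc [0,1,8,3,6,2,4,5], Cyc [0,1,7,4,3,6,2,5], Cyc
    [0,1,7,2,6,3,4,5], Cyc [0,1,8,2,6,3,4,5], Twin [5,0,1,7,4,3,6,2,9] [5,4,7,1,8,3,6,2,9]], Cyc
    [0,1,8,3,6,2,4,5], Cyc [0,1,7,4,3,6,2,5], Cyc [0,1,7,2,6,3,4,5], Cyc [0,1,8,2,6,3,4,5], Twin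
    [5,0,1,7,4,3,6,2,9] [5,4,7,1,8,3,6,2,9]], At 5 [Cyc [0,2,3,8,1,7,4,5], At 7 [Cyc [0,2,3,8,1,7,4,5],
    Cyc [0,1,8,3,2,6,4,5], Cyc [0,1,7,4,3,2,6,5], Cyc [0,1,2,3,6,7,4,5], Cyc [0,1,2,6,8,3,4,5], Cyc
    [0,1,2,9,6,3,4,5]], Cyc [0,1,8,3,6,2,4,5], Cyc [0,1,7,4,3,6,2,5], Cyc [0,1,7,2,6,3,4,5], Cyc
    [0,1,8,2,6,3,4,5], Twin [5,0,1,7,4,3,6,2,9] [5,4,7,1,8,3,6,2,9]]])]], At 3 [Cyc [0,1,2,6,3,4,7,5],
    Cyc [1,2,6,3,4,5,7,8]]], At 2 [At 3 [Cyc [0,1,7,3,2,6,4,5]], At 3 [Cyc [0,1,2,6,4,3,7,5], Twin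
    [0,1,8,7,5,4,3,2,6] [0,5,7,8,1,2,3,4,6]]], At 5 [Cyc [0,1,2,6,7,3,4,5], At 2 [Cyc [0,1,2,6,7,4,3,5],
    Twin [3,2,6,7,4,1,0,5,8] [3,4,7,6,2,1,0,5,8]], Cyc [0,1,8,7,6,2,3,4,5]]]], At 2 [At 7 [At 3 [At 5
    [At 6 [Cyc [0,1,7,8,4,2,3,5]]], Cyc [0,5,4,2,1,7,3,6]], At 5 [At 6 [Cyc [0,1,2,5,7,4,3,6]], At 6
    [Cyc [0,1,7,4,5,2,3,6], Cyc [0,1,7,8,5,2,3,6]]], At 6 [At 3 [Cyc [0,1,2,7,4,5,3,6], Cyc
    [0,1,8,3,2,7,4,5]], Cyc [0,1,2,7,5,4,3,6], At 3 [Twin [5,0,6,3,4,1,2,7,8] [5,4,1,0,6,3,2,7,8], Twin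
    [4,3,6,0,5,1,2,7,8] [4,5,1,0,6,3,2,7,8], Twin [5,0,6,3,9,1,2,7,8] [5,4,3,6,0,1,2,7,8]]]], At 5 [At 6
    [At 3 [Cyc [0,5,3,2,1,7,4,6]], At 7 [Cyc [0,1,2,3,7,5,4,6], Cyc [0,1,2,8,7,3,4,5]]], At 6 [At 3 [Cyc
    [0,5,3,2,1,7,4,6]], At 7 [Cyc [0,1,2,3,7,5,4,6], Cyc [0,1,2,8,7,5,4,6]]], At 6 [At 7 [Cyc
    [0,1,7,3,2,5,4,6], Twin [5,0,6,4,3,8,2,1,7] [5,4,6,0,1,2,8,3,7]], Cyc [0,5,7,1,2,3,4,6], At 7 [Twin
    [2,1,7,8,3,4,5,0,6] [2,3,8,7,1,0,5,4,6], Cyc [0,1,7,8,5,2,3,4,6], Cyc [0,1,7,8,9,2,3,4,5]]]], At 7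
    [At 5 [At 6 [Cyc [0,1,2,3,7,4,5,6]], At 6 [At 3 [Join 1 6 (Twin [2,3,4,7,1,0,6,5,8]
    [2,3,4,7,1,6,0,5,8]) (Via 0 [At 1 [Cyc [0,2,3,4,7,1,8,5], Cyc [0,3,2,1,7,4,5,6], Cyc
    [0,4,3,2,1,8,5,6], At 3 [Cyc [0,2,3,4,7,1,5,6], Cyc [0,3,2,1,7,4,5,6], Cyc [0,4,3,2,1,8,5,6], Cyc
    [0,5,8,1,2,3,4,7], Cyc [0,6,5,4,3,2,1,8], Twin [2,3,4,7,1,5,6,0,9] [2,3,4,7,1,8,5,0,9]], Cyc
    [0,5,8,1,2,3,4,7], Cyc [0,6,5,4,3,2,1,8], Cyc [0,6,5,4,3,2,1,9]], At 2 [Cyc [0,2,3,4,7,1,8,5], Cyc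
    [0,3,2,1,7,4,5,6], Cyc [0,4,3,2,1,8,5,6], At 4 [Cyc [0,2,3,4,7,1,8,5], Cyc [0,3,2,1,7,4,5,6], Cyc
    [0,4,3,2,1,8,5,6], Cyc [0,5,8,1,2,3,4,7], Cyc [0,6,5,4,3,2,1,8], Twin [3,2,1,7,4,5,6,0,9]
    [3,4,7,1,8,5,6,0,9]], Cyc [0,5,8,1,2,3,4,7], Cyc [0,6,5,4,3,2,1,8], Twin [3,2,1,7,4,5,6,0,9]
    [3,4,7,1,8,5,6,0,9]], At 3 [Cyc [0,2,3,4,7,1,8,5], Cyc [0,3,2,1,7,4,5,6], Cyc [0,4,3,2,1,8,5,6], At
    5 [Cyc [0,2,3,4,7,1,8,5], Cyc [0,3,2,1,7,4,5,6], Cyc [0,4,3,2,1,8,5,6], Cyc [0,5,8,1,2,3,4,7], Cyc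
    [0,6,5,4,3,2,1,8], Twin [3,2,1,7,4,5,6,0,9] [3,4,7,1,8,5,6,0,9]], Cyc [0,5,8,1,2,3,4,7], Cyc
    [0,6,5,4,3,2,1,8], Twin [3,2,1,7,4,5,6,0,9] [3,4,7,1,8,5,6,0,9]], At 4 [Cyc [0,2,3,4,7,1,8,5], Cyc
    [0,3,2,1,7,4,5,6], Cyc [0,4,3,2,1,8,5,6], At 6 [Cyc [0,2,3,4,7,1,8,5], Cyc [0,3,2,1,7,4,5,6], Cyc
    [0,4,3,2,1,8,5,6], Cyc [0,5,8,1,2,3,4,7], Cyc [0,6,5,4,3,2,1,8], Twin [3,2,1,7,4,5,6,0,9]
    [3,4,7,1,8,5,6,0,9]], Cyc [0,5,8,1,2,3,4,7], Cyc [0,6,5,4,3,2,1,8], Twin [3,2,1,7,4,5,6,0,9]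
    [3,4,7,1,8,5,6,0,9]], At 5 [Cyc [0,2,3,4,7,1,8,5], Cyc [0,3,2,1,7,4,5,6], Cyc [0,4,3,2,1,8,5,6], At
    7 [Cyc [0,1,7,4,3,2,6,5], Cyc [0,3,2,1,7,4,5,6], Cyc [0,4,3,2,1,8,5,6], Cyc [0,1,2,3,4,5,6,7], Cyc
    [0,1,2,3,4,5,6,8], Cyc [0,1,2,3,4,5,6,9]], Cyc [0,5,8,1,2,3,4,7], Cyc [0,6,5,4,3,2,1,8], Twin
    [3,2,1,7,4,5,6,0,9] [3,4,7,1,8,5,6,0,9]]])], Cyc [0,1,7,8,3,4,5,6]]], At 5 [At 6 [Cyc
    [0,1,2,3,7,4,5,6]], At 6 [Cyc [0,1,7,3,2,4,5,6], Twin [3,2,1,7,8,4,5,0,6] [3,2,4,8,7,1,0,5,6]]], At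
    6 [Cyc [0,1,2,7,3,4,5,6], At 3 [Cyc [0,1,2,7,4,3,5,6], Twin [3,2,7,4,5,6,0,1,8]
    [3,4,7,2,1,0,6,5,8]], At 5 [Cyc [0,1,2,7,8,3,4,5], Cyc [0,1,2,7,8,4,5,6], Cyc
    [0,1,9,8,7,2,3,4,5]]]], At 3 [At 7 [Cyc [0,5,4,2,1,3,7,6], Cyc [0,1,2,5,4,3,7,6], At 6 [Cyc
    [0,1,2,8,4,3,7,6], Cyc [0,5,8,2,1,3,7,6], Twin [4,3,7,6,0,1,2,8,9] [4,5,0,6,7,3,2,8,9]]], At 7 [At 6
    [Cyc [0,1,2,3,5,4,7,6], Twin [5,0,6,7,4,1,2,3,8] [5,4,7,6,0,1,2,3,8]], At 5 [Cyc [0,1,3,2,5,4,7,6],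
    Twin [3,2,5,0,6,7,4,1,8] [3,2,5,4,7,6,0,1,8]], At 6 [Cyc [0,1,2,8,3,4,7,6], Cyc [0,1,2,8,5,4,7,6],
    Twin [5,0,6,7,4,1,2,8,9] [5,0,6,7,4,3,2,8,9]]], Cyc [0,1,2,3,4,5,7,6], Cyc [0,5,4,3,2,1,8,7,6]]]]"

definition clique_tree :: search where
  "clique_tree =
    Via 0 [At 7 [At 1 [At 3 [At 4 [At 5 [At 6 [Cyc [0,1,2,8,7,5,3,4]]], At 5 [Cyc [0,1,3,4,7,5,2,6],
    Twin [0,6,2,1,3,5,4,7,8] [0,6,2,1,5,3,4,7,8]]], Like 4, At 4 [Cyc [0,6,2,1,3,5,4,7], Like 4, Twin
    [1,3,4,5,2,6,0,7,8] [1,3,5,4,2,6,0,7,8]]], Like 3, Like 3, Cyc [0,6,2,3,4,5,1,7]], Like 2, Like 2,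
    Like 2, At 6 [Cyc [0,1,3,4,5,2,7,6], Like 2, Like 2, Like 2, Twin [1,2,3,4,5,0,6,7,8]
    [1,2,3,5,4,0,6,7,8]]], At 7 [At 1 [At 2 [At 4 [At 5 [At 6 [Cyc [0,1,2,8,7,5,3,4]]], At 5 [Cyc
    [0,6,2,1,3,4,5,7], Twin [1,3,4,5,2,6,0,7,8] [1,3,5,4,2,6,0,7,8]]], Like 4, Cyc [0,6,2,1,4,5,3,7]],
    Like 3, Like 3, At 2 [Cyc [0,1,7,3,4,5,2,6], Like 3, Like 3, Cyc [0,2,3,4,5,1,7,8]]], Like 2, Like
    2, Like 2, At 6 [Cyc [0,1,3,4,5,2,7,6], Like 2, Like 2, Like 2, Twin [1,2,3,4,5,0,6,7,8]
    [1,2,3,5,4,0,6,7,8]]], At 7 [At 1 [At 2 [At 3 [At 5 [At 6 [Cyc [0,1,3,4,5,2,8,7]]], Cyc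
    [0,6,2,1,3,5,4,7]], Like 4, At 3 [Cyc [0,1,3,7,4,5,2,6], Like 4, Cyc [0,1,2,4,5,3,7,8]]], Like 3,
    Like 3, At 2 [Cyc [0,1,7,3,4,5,2,6], Like 3, Like 3, Twin [0,6,2,3,4,5,1,7,8] [0,6,2,3,5,4,1,7,8]]],
    Like 2, Like 2, Like 2, At 6 [Cyc [0,1,3,4,5,2,7,6], Like 2, Like 2, Like 2, Twin
    [1,2,3,4,5,0,6,7,8] [1,2,3,5,4,0,6,7,8]]], At 7 [At 1 [At 2 [At 3 [At 4 [Cyc [0,6,2,1,3,4,5,7]], At
    4 [Cyc [0,1,3,4,7,5,2,6], Cyc [0,1,2,3,5,4,7,8]]], Like 4, At 3 [Cyc [0,1,3,7,4,5,2,6], Like 4, Twin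
    [0,6,2,1,4,5,3,7,8] [0,6,2,1,5,4,3,7,8]]], Like 3, Like 3, At 2 [Cyc [0,1,7,3,4,5,2,6], Like 3, Like
    3, Twin [0,6,2,3,4,5,1,7,8] [0,6,2,3,5,4,1,7,8]]], Like 2, Like 2, Like 2, At 6 [Cyc
    [0,1,3,4,5,2,7,6], Like 2, Like 2, Like 2, Twin [1,2,3,4,5,0,6,7,8] [1,2,3,5,4,0,6,7,8]]], At 1 [At
    2 [At 3 [At 4 [At 5 [At 7 [Twin [1,2,3,4,5,7,0,6,8] [1,2,4,3,5,7,0,6,8]]], At 5 [At 7 [Twin
    [1,2,3,4,7,5,0,6,8] [1,2,3,5,7,4,0,6,8]], Cyc [0,1,2,3,5,4,7,8]]], Like 4, At 4 [At 7 [Cyc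
    [0,1,2,3,7,4,5,6], Twin [1,2,3,7,4,5,0,6,8] [1,2,4,7,3,5,0,6,8]], Like 4, Twin [6,0,1,2,4,5,3,7,8]
    [6,0,1,2,5,4,3,7,8]]], Like 3, Like 3, At 3 [At 7 [Cyc [0,1,2,7,3,5,4,6], Like 4, Twin
    [1,2,7,3,4,5,0,6,8] [1,2,7,3,5,4,0,6,8]], Like 3, Like 3, Twin [6,0,1,3,4,5,2,7,8]
    [6,0,1,3,5,4,2,7,8]]], Like 2, Like 2, Like 2, At 2 [At 7 [Cyc [0,1,7,2,4,5,3,6], Like 3, Like 3,
    Twin [1,7,2,3,4,5,0,6,8] [1,7,2,3,5,4,0,6,8]], Like 2, Like 2, Like 2, Twin [6,0,2,3,4,5,1,7,8]
    [6,0,2,3,5,4,1,7,8]]]]"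

text \<open>Evaluation rules for the list of labels: the lower bounds 0 and 1 are not of the form \<open>numeral k\<close> to
  which the simplifier's rules for list intervals apply.\<close>

lemma upt_from_0_1:
  "[0..<numeral k] = 0 # [1..<numeral k]"
  "[1..<numeral k] = (if (1::nat) < numeral k then 1 # [2..<numeral k] else [])"
  by (simp add: upt_rec[of 0], subst upt_rec, simp add: numeral_2_eq_2)

lemma hexagon_tree_2: "check 6 hexagon_edges [(2, 1), (0, 0), (8, 2)] hexagon_tree_2"
  by (simp add: hexagon_edges_def hexagon_tree_2_def new_edges_def transpose_def upt_from_0_1
      del: One_nat_def cong del: successively_cong)

lemma hexagon_tree_3: "check 6 hexagon_edges [(3, 1), (0, 0), (8, 2)] hexagon_tree_3"
  by (simp add: hexagon_edges_def hexagon_tree_3_def new_edges_def transpose_def upt_from_0_1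
      del: One_nat_def cong del: successively_cong)

lemma hexagon_tree_4: "check 6 hexagon_edges [(4, 1), (0, 0), (8, 2)] hexagon_tree_4"
  by (simp add: hexagon_edges_def hexagon_tree_4_def new_edges_def transpose_def upt_from_0_1
      del: One_nat_def cong del: successively_cong)

lemma clique_tree: "check 7 clique_pendant_edges [(0, 1), (8, 6)] clique_tree"
  by (simp add: clique_pendant_edges_def clique_tree_def new_edges_def transpose_def upt_from_0_1
      del: One_nat_def cong del: successively_cong)

section \<open>Six-cycles and cliques\<close>

lemma lessThan_6: "{..<6::nat} = {0, 1, 2, 3, 4, 5}" and lessThan_7: "{..<7::nat} = {0, 1, 2, 3, 4, 5, 6}"
  by auto

context unique_long_paths
begin

definition hexagon :: "'a \<Rightarrow> 'a \<Rightarrow> 'a \<Rightarrow> 'a \<Rightarrow> 'a \<Rightarrow> 'a \<Rightarrow> bool" where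
  "hexagon a b c d e g \<longleftrightarrow> distinct [a, b, c, d, e, g] \<and> successively adj [a, b, c, d, e, g, a]"

lemma adj_in_right: "adj x y \<Longrightarrow> y \<in> V"
  using adj_in adj_sym by blast

lemma hexagon_embeds:
  assumes "hexagon a b c d e g"
  shows "embeds 6 hexagon_edges ((!) [a, b, c, d, e, g])"
proof -
  have "inj_on ((!) [a, b, c, d, e, g]) {..<6}"
    using assms by (intro inj_on_nth) (auto simp: hexagon_def)
  then show ?thesis
    using assms unfolding embeds_def lessThan_6 hexagon_def hexagon_edges_def
    using adj_commute adj_in by auto
qed

lemma hexagon_reflect: "hexagon a b c d e g \<Longrightarrow> hexagon c b a g e d"
  by (auto simp: hexagon_def adj_commute)

lemma hexagon_rotate: "hexagon a b c d e g \<Longrightarrow> hexagon b c d e g a"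
  by (auto simp: hexagon_def)

lemma no_long_path_early_centre:
  assumes h: "hexagon a b c d e g"
    and xs: "length xs = 9" "distinct xs" "successively adj xs" "hd xs = a" "last xs = c"
    and i: "xs ! i = b" "i \<in> {2, 3, 4}"
  shows False
proof -
  have path: "long_path 6 ((!) [a, b, c, d, e, g]) [(i, 1), (0, 0), (8, 2)] xs"
    using xs i nine_ends[OF xs(1)] by (auto simp: long_path_def)
  obtain t where "check 6 hexagon_edges [(i, 1), (0, 0), (8, 2)] t"
    using i(2) hexagon_tree_2 hexagon_tree_3 hexagon_tree_4 by blast
  then show False
    using hexagon_embeds[OF h] path by (rule check_sound(1))
qed

text \<open>If the common neighbour \<open>b\<close> lies in the second half of the path, reverse the path and reflect the
  hexagon in \<open>b\<close>, so that the searches only concern the positions 2, 3 and 4.\<close>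

lemma hexagon_short_chord:
  assumes h: "hexagon a b c d e g"
  shows "adj a c"
proof (rule ccontr)
  assume "\<not> adj a c"
  moreover have ac: "a \<noteq> c" "adj a b" "adj b c" "adj c d"
    using h by (simp_all add: hexagon_def)
  moreover have "a \<in> V" "c \<in> V"
    using adj_in[OF ac(2)] adj_in[OF ac(4)] by simp_all
  ultimately obtain xs
    where xs: "length xs = 9" "distinct xs" "successively adj xs" "hd xs = a" "last xs = c"
    using path_exists[of a c] by auto
  obtain i where i: "i \<in> {2, 3, 4, 5, 6}" "xs ! i = b"
    by (rule path_through_common_neighbour[OF xs(1-3), of b]) (use ac xs in simp_all)
  show False
  proof (cases "i \<in> {2, 3, 4}")
    case True
    show False by (rule no_long_path_early_centre[OF h xs i(2) True])
  next
    case False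
    then have i': "8 - i \<in> {2, 3, 4}" and "i \<le> 8" using i(1) by auto
    have "length (rev xs) = 9" "distinct (rev xs)" using xs(1,2) by simp_all
    moreover have "successively adj (rev xs)"
      unfolding successively_rev by (rule successively_mono[OF xs(3)]) (rule adj_sym)
    moreover have "hd (rev xs) = c" "last (rev xs) = a"
      using xs(1,4,5) by (auto simp: hd_rev last_rev)
    moreover have "rev xs ! (8 - i) = b"
      using i(2) \<open>i \<le> 8\<close> xs(1) by (simp add: rev_nth)
    ultimately show False
      using i' by (rule no_long_path_early_centre[OF hexagon_reflect[OF h]])
  qed
qed

definition clique :: "'a set \<Rightarrow> bool" where
  "clique Q \<longleftrightarrow> Q \<subseteq> V \<and> (\<forall>x \<in> Q. \<forall>y \<in> Q. x \<noteq> y \<longrightarrow> adj x y)"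

text \<open>Rotations of the hexagon give all pairs at distance two. With these chords present, exchanging two
  consecutive vertices of the hexagon gives another hexagon, in which two opposite vertices of the old
  one have distance two.\<close>

lemma hexagon_clique:
  assumes h: "hexagon a b c d e g"
  shows "clique {a, b, c, d, e, g}"
proof -
  have short: "adj a c \<and> adj b d \<and> adj c e \<and> adj d g \<and> adj e a \<and> adj g b" if "hexagon a b c d e g" for a b c d e g
    using that by (meson hexagon_rotate hexagon_short_chord)
  have long: "adj a d" if h: "hexagon a b c d e g" for a b c d e g
  proof -
    have "hexagon a b d c e g"
      using h short[OF h] by (auto simp: hexagon_def adj_commute)
    then show ?thesis by (rule hexagon_short_chord)
  qed
  have "adj a d" "adj b e" "adj c g"
    using h by (meson hexagon_rotate long)+
  then show ?thesis
    using h short[OF h] by (auto simp: clique_def hexagon_def adj_commute intro: adj_in adj_in_right)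
qed

text \<open>Here \<open>a\<close> receives the label 0, \<open>b\<close> the label 1 and \<open>x\<close> the label 6.\<close>

lemma clique_pendant:
  assumes Q: "clique Q" "card Q = 6" and x: "x \<notin> Q" "a \<in> Q" "adj a x" and b: "b \<in> Q"
  shows "adj b x"
proof (cases "a = b")
  case True
  then show ?thesis using x by simp
next
  case False
  have "finite Q" using Q(2) by (metis card.infinite zero_neq_numeral)
  moreover have "card (Q - {a, b}) = 4"
    using Q(2) x(2) b False \<open>finite Q\<close> by (simp add: card_Diff_subset)
  ultimately obtain ws where "set ws = Q - {a, b}" "distinct ws" "length ws = 4"
    by (metis finite_Diff finite_distinct_list distinct_card)
  then obtain c d e g where ws: "set [c, d, e, g] = Q - {a, b}" "distinct [c, d, e, g]"
    by (auto simp: numeral_eq_Suc length_Suc_conv)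
  let ?l = "[a, b, c, d, e, g, x]"
  have Qeq: "Q = {a, b, c, d, e, g}" using ws(1) x(2) b by auto
  have dist: "distinct ?l" using ws x b False by auto
  have "inj_on ((!) ?l) {..<7}"
    using dist by (intro inj_on_nth) auto
  moreover have "\<forall>y\<in>Q. \<forall>z\<in>Q. y \<noteq> z \<longrightarrow> adj y z" "Q \<subseteq> V" "x \<in> V"
    using Q(1) x(3) adj_in_right by (auto simp: clique_def)
  ultimately have emb: "embeds 7 clique_pendant_edges ((!) ?l)"
    using x(3) dist unfolding embeds_def lessThan_7 clique_pendant_edges_def Qeq by auto
  show ?thesis
  proof (rule ccontr)
    assume "\<not> adj b x"
    then obtain xs
      where xs: "length xs = 9" "distinct xs" "successively adj xs" "hd xs = b" "last xs = x"
      using path_exists[of b x] dist Q(1) b adj_in_right[OF x(3)] by (auto simp: clique_def)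
    then have "long_path 7 ((!) ?l) [(0, 1), (8, 6)] xs"
      using nine_ends[OF xs(1)] by (auto simp: long_path_def)
    then show False
      by (rule check_sound(1)[OF clique_tree emb])
  qed
qed

lemma clique_insert:
  assumes Q: "clique Q" "card Q = 6" and x: "x \<notin> Q" "a \<in> Q" "adj a x"
  shows "clique (insert x Q)"
  using clique_pendant[OF Q x] Q(1) adj_in_right[OF x(3)] by (auto simp: clique_def adj_commute)

text \<open>For each \<open>b\<close> in a 7-clique there is a 6-clique inside it that contains \<open>b\<close> and the neighbour \<open>a\<close> of \<open>x\<close>.\<close>

lemma clique_insert7:
  assumes Q: "clique Q" "card Q = 7" and x: "x \<notin> Q" "a \<in> Q" "adj a x"
  shows "clique (insert x Q)"
proof -
  have "adj b x" if "b \<in> Q" for b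
  proof -
    have "finite Q" using Q(2) by (metis card.infinite zero_neq_numeral)
    moreover have "card {a, b} < card Q" using Q(2) by (simp add: card_insert_if)
    ultimately obtain z where z: "z \<in> Q" "z \<noteq> a" "z \<noteq> b"
      by (metis card_mono finite.emptyI finite_insert insertCI leD subsetI)
    have "clique (Q - {z})" "card (Q - {z}) = 6"
      using Q z by (auto simp: clique_def)
    then show ?thesis
      using clique_pendant[of "Q - {z}" x a b] x z that by auto
  qed
  then show ?thesis
    using Q(1) adj_in_right[OF x(3)] by (auto simp: clique_def adj_commute)
qed

lemma no_clique_8:
  assumes "clique Q" "card Q = 8"
  shows False
proof -
  have "finite Q" using assms(2) by (metis card.infinite zero_neq_numeral)
  then obtain ws where ws: "set ws = Q" "distinct ws" "length ws = 8"
    using assms(2) by (metis finite_distinct_list distinct_card)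
  have "ws \<noteq> []" using ws(3) by auto
  have adj: "adj x y" if "x \<in> Q" "y \<in> Q" "x \<noteq> y" for x y
    using assms(1) that by (auto simp: clique_def)
  have "successively adj ws"
    unfolding successively_conv_nth using ws by (auto intro!: adj simp: nth_eq_iff_index_eq)
  moreover have "adj (last ws) (hd ws)"
    using ws \<open>ws \<noteq> []\<close> by (intro adj) (auto simp: last_conv_nth hd_conv_nth nth_eq_iff_index_eq)
  ultimately show False
    using no_cycle[of ws] ws \<open>ws \<noteq> []\<close> by (auto simp: successively_Cons)
qed

text \<open>The hexagon spans a 6-clique. Connectedness supplies a vertex attached to it, giving a 7-clique, and
  then a vertex attached to that, giving an 8-clique.\<close>

theorem hexagon_impossible:
  assumes h: "hexagon a b c d e g" and "9 \<le> card V"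
    and conn: "\<And>Q. Q \<subset> V \<Longrightarrow> Q \<noteq> {} \<Longrightarrow> \<exists>a \<in> Q. \<exists>x \<in> V - Q. adj a x"
  shows False
proof -
  let ?Q = "{a, b, c, d, e, g}"
  have grow: "\<exists>a \<in> Q. \<exists>x. x \<notin> Q \<and> adj a x" if "clique Q" "0 < card Q" "card Q < 9" for Q
  proof -
    have "Q \<subseteq> V" "Q \<noteq> V" "Q \<noteq> {}" using that \<open>9 \<le> card V\<close> by (auto simp: clique_def)
    then show ?thesis using conn[of Q] by blast
  qed
  have Q6: "clique ?Q" "card ?Q = 6"
    using hexagon_clique[OF h] h by (auto simp: hexagon_def)
  then obtain p x where x: "p \<in> ?Q" "x \<notin> ?Q" "adj p x" using grow[of ?Q] by auto
  then have Q7: "clique (insert x ?Q)" "card (insert x ?Q) = 7"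
    using clique_insert[OF Q6] Q6(2) by auto
  then obtain q y where y: "q \<in> insert x ?Q" "y \<notin> insert x ?Q" "adj q y" using grow[of "insert x ?Q"] by auto
  then have "clique (insert y (insert x ?Q))" "card (insert y (insert x ?Q)) = 8"
    using clique_insert7[OF Q7] Q7(2) by auto
  then show False by (rule no_clique_8)
qed

end

section \<open>Cycles of the graph as vertex lists\<close>

abbreviation arc_rel :: "'a pair_pre_digraph \<Rightarrow> 'a \<Rightarrow> 'a \<Rightarrow> bool" where
  "arc_rel H x y \<equiv> (x, y) \<in> parcs H"

fun path_edges :: "'a list \<Rightarrow> 'a set set" where
  "path_edges (x # y # xs) = insert {x, y} (path_edges (y # xs))"
| "path_edges _ = {}"

lemma path_edges_subset: "e \<in> path_edges xs \<Longrightarrow> e \<subseteq> set xs"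
  by (induction xs rule: path_edges.induct) auto

lemma path_edges_successively:
  "successively R xs \<Longrightarrow> {u, v} \<in> path_edges xs \<Longrightarrow> R u v \<or> R v u"
  by (induction xs rule: path_edges.induct) (auto simp: doubleton_eq_iff)

lemma path_edges_Cons: "xs \<noteq> [] \<Longrightarrow> path_edges (x # xs) = insert {x, hd xs} (path_edges xs)"
  by (cases xs) auto

text \<open>A path is determined by its first vertex and its edges, as its first vertex is on one edge only. This
  turns the uniqueness of cycles as edge sets into the uniqueness of long paths.\<close>

lemma path_edges_inject:
  assumes "length xs = length ys" "distinct xs" "distinct ys" "hd xs = hd ys" "path_edges xs = path_edges ys"
  shows "xs = ys"
  using assms
proof (induction xs ys rule: list_induct2)
  case (Cons x xs y ys)
  have [simp]: "y = x" using Cons.prems by simp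
  show ?case
  proof (cases "xs = []")
    case True
    then show ?thesis using Cons by auto
  next
    case False
    then have ne: "xs \<noteq> []" "ys \<noteq> []" using Cons.hyps by auto
    have notin: "x \<notin> e" if "e \<in> path_edges xs \<union> path_edges ys" for e
      using that Cons.prems path_edges_subset by fastforce
    have eq: "insert {x, hd xs} (path_edges xs) = insert {x, hd ys} (path_edges ys)"
      using Cons.prems(4) ne by (simp add: path_edges_Cons)
    have "{x, hd ys} \<in> insert {x, hd xs} (path_edges xs)" using eq by simp
    then have hds: "{x, hd ys} = {x, hd xs}" using notin[of "{x, hd ys}"] by auto
    have "path_edges xs = path_edges ys"
    proof (rule insert_ident[THEN iffD1])
      show "{x, hd xs} \<notin> path_edges xs" "{x, hd xs} \<notin> path_edges ys"
        using notin[of "{x, hd xs}"] by auto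
      show "insert {x, hd xs} (path_edges xs) = insert {x, hd xs} (path_edges ys)"
        using eq unfolding hds .
    qed
    moreover have "hd xs = hd ys" using hds by (auto simp: doubleton_eq_iff)
    ultimately show ?thesis using Cons.IH Cons.prems by simp
  qed
qed simp

lemma awalk_of_list:
  assumes "successively (arc_rel H) (a # xs)"
  shows "pcas a (zip (a # xs) xs) (last (a # xs))" "set (zip (a # xs) xs) \<subseteq> parcs H"
    "pawalk_verts a (zip (a # xs) xs) = a # xs" "walk_edges (zip (a # xs) xs) = path_edges (a # xs)"
  using assms by (induction xs arbitrary: a) (auto simp: walk_edges_def)

lemma list_of_awalk:
  assumes "pcas u p v" "set p \<subseteq> parcs H"
  shows "successively (arc_rel H) (u # map snd p)" "last (u # map snd p) = v"
    "pawalk_verts u p = u # map snd p" "walk_edges p = path_edges (u # map snd p)"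
  using assms by (induction p arbitrary: u) (auto simp: walk_edges_def)

lemma cycles_of_length_lists:
  assumes "parcs H \<subseteq> pverts H \<times> pverts H"
  shows "C \<in> cycles_of_length n H \<longleftrightarrow> 3 \<le> n \<and> (\<exists>xs. length xs = n \<and> distinct xs \<and>
    successively (arc_rel H) (last xs # xs) \<and> C = path_edges (last xs # xs))"
proof (intro iffI conjI)
  assume "C \<in> cycles_of_length n H"
  then obtain p u where p: "C = walk_edges p" "length p = n" "3 \<le> n" "u \<in> pverts H" "set p \<subseteq> parcs H"
    "pcas u p u" "distinct (tl (pawalk_verts u p))"
    by (auto simp: cycles_of_length_def pre_digraph.cycle_def pre_digraph.awalk_def
        cas_with_proj_eq awalk_verts_with_proj_eq)
  note l = list_of_awalk[OF p(6,5)]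
  have "p \<noteq> []" using p(2,3) by auto
  then have "last (map snd p) = u" using l(2) by auto
  then show "\<exists>xs. length xs = n \<and> distinct xs \<and>
    successively (arc_rel H) (last xs # xs) \<and> C = path_edges (last xs # xs)"
    using l p by (intro exI[of _ "map snd p"]) auto
  show "3 \<le> n" by (rule p)
next
  assume "3 \<le> n \<and> (\<exists>xs. length xs = n \<and> distinct xs \<and>
    successively (arc_rel H) (last xs # xs) \<and> C = path_edges (last xs # xs))"
  then obtain xs where xs: "3 \<le> n" "length xs = n" "distinct xs" "successively (arc_rel H) (last xs # xs)"
    "C = path_edges (last xs # xs)" by blast
  let ?p = "zip (last xs # xs) xs"
  have "xs \<noteq> []" using xs(1,2) by auto
  then have "arc_rel H (last xs) (hd xs)" using xs(4) by (simp add: successively_Cons)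
  then have "last xs \<in> pverts H" using assms by auto
  then have "pre_digraph.cycle (with_proj H) ?p"
    using awalk_of_list[OF xs(4)] xs(3) \<open>xs \<noteq> []\<close>
    unfolding pre_digraph.cycle_def pre_digraph.awalk_def cas_with_proj_eq awalk_verts_with_proj_eq
    by (intro exI[of _ "last xs"]) (auto simp: zip_eq_Nil_iff)
  then show "C \<in> cycles_of_length n H"
    using awalk_of_list(4)[OF xs(4)] xs unfolding cycles_of_length_def
    by (intro CollectI exI[of _ ?p]) auto
qed

lemma not_successively_split:
  "\<not> successively P zs \<Longrightarrow> \<exists>us p q vs. zs = us @ p # q # vs \<and> \<not> P p q"
proof (induction P zs rule: successively.induct)
  case (3 P x y zs)
  show ?case
  proof (cases "P x y")
    case True
    then obtain us p q vs where "y # zs = us @ p # q # vs" "\<not> P p q" using 3 by auto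
    then show ?thesis by (intro exI[of _ "x # us"]) auto
  next
    case False
    then show ?thesis by (intro exI[of _ "[]"]) auto
  qed
qed auto

text \<open>The path consists of the part of the list that starts at \<open>q\<close>, followed by the part that ends at \<open>p\<close>;
  they are joined by the closing edge of the cycle.\<close>

lemma cycle_open_at:
  assumes "distinct xs" "successively R (last xs # xs)" "last xs # xs = us @ p # q # vs" 
  obtains ys where "length ys = length xs" "distinct ys" "successively R ys" "last ys = p" "hd ys = q"
proof (cases us)
  case Nil
  then show thesis using assms by (intro that[of xs]) (auto simp: successively_Cons)
next
  case (Cons w us')
  then have xs: "xs = us' @ p # q # vs" and w: "w = last (q # vs)" using assms(3) by auto
  have "successively R ((q # vs) @ us' @ [p])"
    using assms(2) xs w by (auto simp: successively_append_iff successively_Cons hd_append)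
  then show thesis
    using assms(1) xs by (intro that[of "(q # vs) @ us' @ [p]"]) auto
qed

text \<open>A cycle that adding the edge \<open>uv\<close> creates is cut open at this edge. The path that is left does not use
  the edge again, because \<open>u\<close> and \<open>v\<close> are its ends and it has at least three vertices.\<close>

lemma new_cycle_path:
  assumes xs: "distinct xs" "3 \<le> length xs" "successively R' (last xs # xs)"
    "\<not> successively R (last xs # xs)"
    and R': "\<And>x y. R' x y \<Longrightarrow> R x y \<or> {x, y} = {u, v}"
    and sym: "\<And>x y. R x y \<Longrightarrow> R y x"
  obtains ys where "length ys = length xs" "distinct ys" "successively R ys" "hd ys = u" "last ys = v"
proof -
  obtain us p q vs where split: "last xs # xs = us @ p # q # vs" "\<not> R p q"
    using not_successively_split[OF xs(4)] by blast
  have "R' p q"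
    using xs(3) unfolding split(1) by (simp add: successively_append_iff)
  then have pq: "{p, q} = {u, v}" using R' split(2) by blast
  obtain ys where ys: "length ys = length xs" "distinct ys" "successively R' ys" "last ys = p" "hd ys = q"
    using cycle_open_at[OF xs(1,3) split(1)] by blast
  have "ys \<noteq> []" using ys(1) xs(2) by auto
  then have ends: "p = ys ! (length ys - 1)" "q = ys ! 0"
    using ys(4,5) by (simp_all add: last_conv_nth hd_conv_nth)
  have "successively R ys"
    unfolding successively_conv_nth
  proof (intro allI impI)
    fix i assume i: "Suc i < length ys"
    show "R (ys ! i) (ys ! Suc i)"
    proof (rule ccontr)
      assume "\<not> ?thesis"
      then have "{ys ! i, ys ! Suc i} = {ys ! (length ys - 1), ys ! 0}"
        using R'[OF successively_nth[OF ys(3) i]] pq ends by simp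
      then have "i = length ys - 1 \<or> i = 0 \<and> Suc i = length ys - 1"
        using i nth_eq_iff_index_eq[OF ys(2), of i "length ys - 1"] nth_eq_iff_index_eq[OF ys(2), of i 0]
          nth_eq_iff_index_eq[OF ys(2), of "Suc i" "length ys - 1"] \<open>ys \<noteq> []\<close>
        by (auto simp: doubleton_eq_iff)
      then show False using i ys(1) xs(2) by auto
    qed
  qed
  show thesis
  proof (cases "q = u")
    case True
    then have "p = v" using pq by (auto simp: doubleton_eq_iff)
    then show ?thesis using that ys \<open>successively R ys\<close> True by blast
  next
    case False
    then have "p = u" "q = v" using pq by (auto simp: doubleton_eq_iff)
    moreover have "successively R (rev ys)"
      unfolding successively_rev by (rule successively_mono[OF \<open>successively R ys\<close>]) (rule sym)
    ultimately show ?thesis using ys \<open>ys \<noteq> []\<close> by (intro that[of "rev ys"]) (simp_all add: hd_rev last_rev)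
  qed
qed

lemma connected_crossing:
  assumes "connected (with_proj G)" "Q \<subset> pverts G" "Q \<noteq> {}"
    and sym: "\<And>x y. arc_rel G x y \<Longrightarrow> arc_rel G y x"
  shows "\<exists>a \<in> Q. \<exists>x \<in> pverts G - Q. arc_rel G a x"
proof (rule ccontr)
  assume no: "\<not> ?thesis"
  obtain a b where a: "a \<in> Q" and b: "b \<in> pverts G - Q" using assms(2,3) by blast
  have "(a, b) \<in> rtrancl_on (pverts G) ((parcs G)\<^sup>s)"
    using assms(1,2) a b by (auto simp: connected_conv)
  then have "b \<in> Q"
  proof (induction rule: rtrancl_on_induct)
    case base
    show ?case by (rule a)
  next
    case (step x y)
    then have "arc_rel G x y" using sym by (auto simp: symcl_def)
    then show ?case using no step by blast
  qed
  then show False using b by simp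
qed

text \<open>Two long paths between \<open>u\<close> and \<open>v\<close> both become cycles of length 9 once \<open>uv\<close> is added; these have the
  same edges by hypothesis, and leaving out \<open>uv\<close> again shows that the paths have the same edges.\<close>

lemma saturated_unique_long_paths:
  assumes "pair_graph G" and sat: "uniquely_cycle_saturated 9 G" and even: "longest_even_cycle_length_upto 12 G 6"
  shows "unique_long_paths (pverts G) (arc_rel G)"
proof -
  interpret pair_graph G by (rule assms(1))
  have sub: "parcs G \<subseteq> pverts G \<times> pverts G" using wellformed' by auto
  have sub': "parcs (add_edge G u v) \<subseteq> pverts (add_edge G u v) \<times> pverts (add_edge G u v)"
    if "u \<in> pverts G" "v \<in> pverts G" for u v
    using that sub by (auto simp: add_edge_def)
  have sym: "arc_rel G x y \<Longrightarrow> arc_rel G y x" for x y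
    using arcs_symmetric by blast
  have no_cycle: False
    if len: "length xs \<in> {8, 9, 10}" and cyc: "distinct xs" "successively (arc_rel G) (last xs # xs)" for xs
  proof -
    have ne: "cycles_of_length (length xs) G \<noteq> {}"
      using cycles_of_length_lists[OF sub, of "path_edges (last xs # xs)" "length xs"] len cyc by auto
    consider "length xs = 9" | "even (length xs)" "length xs \<le> 12" "6 < length xs" using len by force
    then show False
    proof cases
      case 1
      then show ?thesis using ne sat by (simp add: uniquely_cycle_saturated_def)
    next
      case 2
      then show ?thesis using ne even unfolding longest_even_cycle_length_upto_def by fastforce
    qed
  qed
  show ?thesis
  proof
    show "arc_rel G x y \<Longrightarrow> arc_rel G y x" for x y by (rule sym)
    show "\<not> arc_rel G x x" for x using no_loops' by blast
    show "arc_rel G x y \<Longrightarrow> x \<in> pverts G" for x y using sub by auto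
    show "length xs \<in> {8, 9, 10} \<Longrightarrow> distinct xs \<Longrightarrow> successively (arc_rel G) (last xs # xs) \<Longrightarrow> False" for xs
      by (rule no_cycle)
  next
    fix xs ys
    assume len: "length xs = 9" "length ys = 9" and dist: "distinct xs" "distinct ys"
      and walk: "successively (arc_rel G) xs" "successively (arc_rel G) ys"
      and ends: "hd xs = hd ys" "last xs = last ys"
    let ?u = "hd xs" and ?v = "last xs"
    have ne: "xs \<noteq> []" "ys \<noteq> []" using len by auto
    have "\<not> arc_rel G ?v ?u"
      using no_cycle[of xs] len dist walk ne by (auto simp: successively_Cons)
    then have non: "\<not> arc_rel G ?u ?v" "\<not> arc_rel G ?v ?u" using sym by blast+
    have "?u \<noteq> ?v" using dist(1) len nine_ends[OF len(1)] by (simp add: nth_eq_iff_index_eq)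
    have V: "?u \<in> pverts G" "?v \<in> pverts G"
      using sub successively_nth[OF walk(1), of 0] successively_nth[OF walk(1), of 7] nine_ends[OF len(1)] len by auto
    have cyc: "insert {?v, ?u} (path_edges zs) \<in> cycles_of_length 9 (add_edge G ?u ?v)"
      if "length zs = 9" "distinct zs" "successively (arc_rel G) zs" "hd zs = ?u" "last zs = ?v" for zs
    proof -
      have "zs \<noteq> []" using that by auto
      moreover have "successively (arc_rel (add_edge G ?u ?v)) zs"
        by (rule successively_mono[OF that(3)]) (auto simp: add_edge_def)
      ultimately show ?thesis
        using that unfolding cycles_of_length_lists[OF sub'[OF V]]
        by (auto simp: successively_Cons path_edges_Cons add_edge_def intro!: exI[of _ zs])
    qed
    have "\<exists>!C. C \<in> cycles_of_length 9 (add_edge G ?u ?v)"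
      using sat V \<open>?u \<noteq> ?v\<close> non(1) unfolding uniquely_cycle_saturated_def by blast
    moreover have "insert {?v, ?u} (path_edges xs) \<in> cycles_of_length 9 (add_edge G ?u ?v)"
      by (rule cyc) (use len dist walk in simp_all)
    moreover have "insert {?v, ?u} (path_edges ys) \<in> cycles_of_length 9 (add_edge G ?u ?v)"
      by (rule cyc) (use len dist walk ends in simp_all)
    ultimately have "insert {?v, ?u} (path_edges xs) = insert {?v, ?u} (path_edges ys)"
      by blast
    moreover have "{?v, ?u} \<notin> path_edges xs" "{?v, ?u} \<notin> path_edges ys"
      using path_edges_successively[OF walk(1)] path_edges_successively[OF walk(2)] non by blast+
    ultimately have "path_edges xs = path_edges ys" by (simp add: insert_ident)
    then show "xs = ys"
      using path_edges_inject[OF _ dist] len ends by simp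
  next
    fix u v
    assume V: "u \<in> pverts G" "v \<in> pverts G" and "u \<noteq> v" "\<not> arc_rel G u v"
    then obtain C where "C \<in> cycles_of_length 9 (add_edge G u v)"
      using sat unfolding uniquely_cycle_saturated_def by blast
    then obtain xs where xs: "length xs = 9" "distinct xs"
      "successively (arc_rel (add_edge G u v)) (last xs # xs)"
      unfolding cycles_of_length_lists[OF sub'[OF V]] by blast
    have open_G: "\<not> successively (arc_rel G) (last xs # xs)" using no_cycle[of xs] xs(1,2) by auto
    show "\<exists>xs. length xs = 9 \<and> distinct xs \<and> successively (arc_rel G) xs \<and> hd xs = u \<and> last xs = v"
    proof (rule new_cycle_path[OF xs(2) _ xs(3) open_G, of u v])
      show "3 \<le> length xs" using xs(1) by simp
      show "arc_rel G x y \<or> {x, y} = {u, v}" if "arc_rel (add_edge G u v) x y" for x y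
        using that by (auto simp: add_edge_def)
      show "arc_rel G y x" if "arc_rel G x y" for x y using that by (rule sym)
      fix ys
      assume "length ys = length xs" "distinct ys" "successively (arc_rel G) ys" "hd ys = u" "last ys = v"
      then show ?thesis using xs(1) by auto
    qed
  qed
qed

theorem theorem6p9:
  shows "\<not> (\<exists>G :: 'a pair_pre_digraph.
    pair_graph G \<and> two_connected G \<and>
    9 \<le> card (pverts G) \<and> uniquely_cycle_saturated 9 G \<and>
    longest_even_cycle_length_upto 12 G 6)"
proof (rule notI, elim exE conjE)
  fix G :: "'a pair_pre_digraph"
  assume G: "pair_graph G" and conn: "two_connected G" and card: "9 \<le> card (pverts G)"
    and sat: "uniquely_cycle_saturated 9 G" and even: "longest_even_cycle_length_upto 12 G 6"
  interpret pair_graph G by (rule G)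
  interpret P: unique_long_paths "pverts G" "arc_rel G"
    by (rule saturated_unique_long_paths[OF G sat even])
  have sub: "parcs G \<subseteq> pverts G \<times> pverts G" using wellformed' by auto
  obtain C where "C \<in> cycles_of_length 6 G"
    using even unfolding longest_even_cycle_length_upto_def by blast
  then obtain xs where xs: "length xs = 6" "distinct xs" "successively (arc_rel G) (last xs # xs)"
    unfolding cycles_of_length_lists[OF sub] by blast
  then obtain a b c d e g where "xs = [a, b, c, d, e, g]"
    by (auto simp: numeral_eq_Suc length_Suc_conv)
  then have "P.hexagon a b c d e g"
    using xs by (simp add: P.hexagon_def)
  then show False
  proof (rule P.hexagon_impossible[OF _ card])
    show "\<exists>a\<in>Q. \<exists>x\<in>pverts G - Q. arc_rel G a x" if "Q \<subset> pverts G" "Q \<noteq> {}" for Q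
      by (rule connected_crossing[OF _ that P.adj_sym]) (use conn in \<open>simp_all add: two_connected_def\<close>)
  qed
qed
end
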